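(* Let $\psi$ satisfy (R1)–(R4), fix $b_1,b_3$ and an integer $N$, and let $\tau_N$ be as defined in the context. Define for $N\ge 0$: $$f(t)=q^{N+1}tb_3(1-q^{-N}b_1)\frac{\tau_N(t,b_1,qb_3)\,\tau_{N+1}(qt,b_1/q,qb_3)}{\tau_N(qt,b_1/q,qb_3)\,\tau_{N+1}(t,b_1,qb_3)},\quad g(t)=-\frac{\tau_N(t,b_1/q,q^2b_3)\,\tau_{N+1}(t,b_1,b_3)}{\tau_N(t,b_1/q,qb_3)\,\tau_{N+1}(t,b_1,qb_3)};$$ for $N<0$: $$f(t)=-\frac{\tau_N(t,qb_1,b_3)\,\tau_{N+1}(qt,b_1,b_3)}{\tau_N(qt,b_1,b_3)\,\tau_{N+1}(t,qb_1,b_3)},\quad g(t)=qt(b_3-1)\frac{\tau_N(t,b_1,qb_3)\,\tau_{N+1}(t,qb_1,b_3/q)}{\tau_N(t,b_1,b_3)\,\tau_{N+1}(t,qb_1,b_3)}.$$ Then $(f,g)$ is a solution of dP$(A_4^{(1)})[q^{-N}b_1,\,q^N,\,b_3]$.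
   Context: $q$ is a fixed nonzero complex constant (generic) and all parameters are generic so that all denominators are nonzero. $\psi(t,b_1,b_3)$ is a function of three variables satisfying, for all values of its arguments: (R1) $\psi(qt,b_1,b_3)=b_1\psi(t,b_1,b_3)+(1-b_1)\psi(qt,b_1/q,b_3)$, (R2) $b_3\psi(qt,b_1,b_3)=\psi(t,b_1,b_3)+(b_3-1)\psi(t,b_1,qb_3)$, (R3) $qtb_1b_3\psi(qt,b_1,b_3)=(qtb_1-1)\psi(t,b_1,b_3)+\psi(t,qb_1,b_3)$, (R4) $qt\psi(qt,b_1,b_3)=(qtb_1-1)\psi(t,b_1,b_3)+\psi(qt,b_1,b_3/q)$. For $N\in\mathbb{Z}$, $\tau_N(t,b_1,b_3)=\det\big(\psi(t,q^{-j+1}b_1,q^{i-1}b_3)\big)_{i,j=1}^N$ if $N>0$, $\tau_0=1$, and $\tau_N(t,b_1,b_3)=\det\big(\psi(t,q^{j-1}b_1,q^{-i+1}b_3)\big)_{i,j=1}^M$ if $N=-M<0$. For parameters $B_1,B_2,B_3$, dP$(A_4^{(1)})[B_1,B_2,B_3]$ is the system for functions $f(t),g(t)$, with $\overline{f}=f(qt)$, $\overline{g}=g(qt)$, $s=s(t)=\frac{1}{qB_1B_2B_3t}$: $$\overline{g}\,g=\frac{qt}{B_2}\frac{(f+B_3)(f+1)}{f+1/s},\qquad \overline{f}\,f=\frac{1}{s}\frac{(\overline{g}+1/B_2)(\overline{g}+1/(B_1B_2))}{\overline{g}+qt/B_2},$$ required to hold for all $t$. *)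

theory Defs
  imports Complex_Main "Jordan_Normal_Form.Determinant"
begin

text \<open>tau_N(t,b1,b3) for an integer N, built from psi (0-based indices i,j;
  entry (i,j) corresponds to the paper's (i+1,j+1)).\<close>
definition tau :: "complex \<Rightarrow> (complex \<Rightarrow> complex \<Rightarrow> complex \<Rightarrow> complex)
                   \<Rightarrow> int \<Rightarrow> complex \<Rightarrow> complex \<Rightarrow> complex \<Rightarrow> complex" where
  "tau q psi N t b1 b3 =
     (if N > 0 then
        det (mat (nat N) (nat N)
          (\<lambda>(i,j). psi t (q powi (- int j) * b1) (q powi (int i) * b3)))
      else if N = 0 then 1
      else
        det (mat (nat (- N)) (nat (- N))
          (\<lambda>(i,j). psi t (q powi (int j) * b1) (q powi (- int i) * b3))))"

definition fnum :: "complex \<Rightarrow> (complex \<Rightarrow> complex \<Rightarrow> complex \<Rightarrow> complex)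
                   \<Rightarrow> int \<Rightarrow> complex \<Rightarrow> complex \<Rightarrow> complex \<Rightarrow> complex" where
  "fnum q psi N b1 b3 t =
     (if N \<ge> 0 then
        q powi (N + 1) * t * b3 * (1 - q powi (- N) * b1)
          * tau q psi N t b1 (q * b3) * tau q psi (N + 1) (q * t) (b1 / q) (q * b3)
      else
        - (tau q psi N t (q * b1) b3 * tau q psi (N + 1) (q * t) b1 b3))"

definition fden :: "complex \<Rightarrow> (complex \<Rightarrow> complex \<Rightarrow> complex \<Rightarrow> complex)
                   \<Rightarrow> int \<Rightarrow> complex \<Rightarrow> complex \<Rightarrow> complex \<Rightarrow> complex" where
  "fden q psi N b1 b3 t =
     (if N \<ge> 0 then
        tau q psi N (q * t) (b1 / q) (q * b3) * tau q psi (N + 1) t b1 (q * b3)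
      else
        tau q psi N (q * t) b1 b3 * tau q psi (N + 1) t (q * b1) b3)"

definition gnum :: "complex \<Rightarrow> (complex \<Rightarrow> complex \<Rightarrow> complex \<Rightarrow> complex)
                   \<Rightarrow> int \<Rightarrow> complex \<Rightarrow> complex \<Rightarrow> complex \<Rightarrow> complex" where
  "gnum q psi N b1 b3 t =
     (if N \<ge> 0 then
        - (tau q psi N t (b1 / q) (q\<^sup>2 * b3) * tau q psi (N + 1) t b1 b3)
      else
        q * t * (b3 - 1) * tau q psi N t b1 (q * b3) * tau q psi (N + 1) t (q * b1) (b3 / q))"

definition gden :: "complex \<Rightarrow> (complex \<Rightarrow> complex \<Rightarrow> complex \<Rightarrow> complex)
                   \<Rightarrow> int \<Rightarrow> complex \<Rightarrow> complex \<Rightarrow> complex \<Rightarrow> complex" where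
  "gden q psi N b1 b3 t =
     (if N \<ge> 0 then
        tau q psi N t (b1 / q) (q * b3) * tau q psi (N + 1) t b1 (q * b3)
      else
        tau q psi N t b1 b3 * tau q psi (N + 1) t (q * b1) b3)"

definition fsol where "fsol q psi N b1 b3 t = fnum q psi N b1 b3 t / fden q psi N b1 b3 t"
definition gsol where "gsol q psi N b1 b3 t = gnum q psi N b1 b3 t / gden q psi N b1 b3 t"

definition sfun :: "complex \<Rightarrow> complex \<Rightarrow> complex \<Rightarrow> complex \<Rightarrow> complex \<Rightarrow> complex" where
  "sfun q B1 B2 B3 t = 1 / (q * B1 * B2 * B3 * t)"

definition dP_eq1 :: "complex \<Rightarrow> complex \<Rightarrow> complex \<Rightarrow> complex
     \<Rightarrow> (complex \<Rightarrow> complex) \<Rightarrow> (complex \<Rightarrow> complex) \<Rightarrow> complex \<Rightarrow> bool" where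
  "dP_eq1 q B1 B2 B3 f g t \<longleftrightarrow>
     g (q * t) * g t = (q * t / B2) * ((f t + B3) * (f t + 1)) / (f t + 1 / sfun q B1 B2 B3 t)"

definition dP_eq2 :: "complex \<Rightarrow> complex \<Rightarrow> complex \<Rightarrow> complex
     \<Rightarrow> (complex \<Rightarrow> complex) \<Rightarrow> (complex \<Rightarrow> complex) \<Rightarrow> complex \<Rightarrow> bool" where
  "dP_eq2 q B1 B2 B3 f g t \<longleftrightarrow>
     f (q * t) * f t = (1 / sfun q B1 B2 B3 t)
        * ((g (q * t) + 1 / B2) * (g (q * t) + 1 / (B1 * B2))) / (g (q * t) + q * t / B2)"

end

theory Submission
  imports Defs
begin

text \<open>
  Write \<open>T\<^sub>N(t, x, y)\<close> for the determinant of \<open>\<psi>(t, x q\<^sup>-\<^sup>j, y q\<^sup>i)\<close> with \<open>0 \<le> i, j < N\<close>. Reversing rows and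
  columns, \<open>\<tau>\<close> with negative index \<open>-M\<close> is \<open>T\<^sub>M(t, q\<^sup>M\<^sup>-\<^sup>1 b\<^sub>1, q\<^sup>1\<^sup>-\<^sup>M b\<^sub>3)\<close>. Each of the factors
  \<open>f + B\<^sub>3\<close>, \<open>f + 1\<close>, \<open>f + 1/s\<close> and \<open>g + 1/B\<^sub>2\<close>, \<open>g + 1/(B\<^sub>1 B\<^sub>2)\<close>, \<open>g + t/B\<^sub>2\<close> is a monomial
  in the \<open>T\<^sub>N\<close> and \<open>T\<^sub>N\<^sub>+\<^sub>1\<close> by a three-term bilinear identity, and in the two equations the monomials cancel.

  All bilinear identities are Pluecker relations. A contiguity relation of \<open>\<psi>\<close> whose coefficients do not
  depend on the row index makes the columns of the determinants chains
  \<open>w\<^sub>k = a\<^sub>k w\<^sub>k\<^sub>+\<^sub>1 + \<alpha>\<^sub>k z\<^sub>k\<close>, so that the determinants of size \<open>N + 1\<close> and, after adding a unit vector, those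
  of size \<open>N\<close> share \<open>N - 1\<close> vectors (likewise with rows and columns exchanged). Where a relation
  carries a coordinatewise factor that may vanish for special parameters, this factor is perturbed and the identity
  follows by continuity, so no genericity is needed.
\<close>

subsection \<open>Determinants and chains of vectors\<close>

text \<open>Matrices are total functions of two indices, so that \<open>f k\<close> is a row and
  exchanging a row is a function update; values outside the square do not matter.\<close>

definition fdet :: "nat \<Rightarrow> (nat \<Rightarrow> nat \<Rightarrow> 'a::comm_ring_1) \<Rightarrow> 'a" where
  "fdet n f = det (mat n n (\<lambda>(i, j). f i j))"

lemma fdet_cong:
  assumes "\<And>i j. i < n \<Longrightarrow> j < n \<Longrightarrow> f i j = g i j"
  shows "fdet n f = fdet n g"
  unfolding fdet_def by (rule arg_cong[where f = det]) (auto simp: assms)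

lemma fdet_0 [simp]: "fdet 0 f = 1"
  by (simp add: fdet_def)

lemma fdet_eq_sum:
  "fdet n f = (\<Sum>p | p permutes {0..<n}. signof p * (\<Prod>i = 0..<n. f i (p i)))"
proof -
  have "(\<Prod>i = 0..<n. mat n n (\<lambda>(i, j). f i j) $$ (i, p i)) = (\<Prod>i = 0..<n. f i (p i))"
    if "p permutes {0..<n}" for p
    using permutes_in_image[OF that] by (intro prod.cong) auto
  then show ?thesis
    unfolding fdet_def det_def by (auto intro!: sum.cong)
qed

lemma fdet_transpose: "fdet n (\<lambda>i j. f j i) = fdet n f"
proof -
  have "mat n n (\<lambda>(i, j). f j i) = transpose_mat (mat n n (\<lambda>(i, j). f i j))"
    by (rule eq_matI) auto
  then show ?thesis
    by (simp add: fdet_def det_transpose[where n = n])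
qed

lemma fdet_row_linear:
  assumes "k < n"
  shows "fdet n (f(k := \<lambda>j. a * x j + b * y j)) = a * fdet n (f(k := x)) + b * fdet n (f(k := y))"
proof -
  have *: "(\<Prod>i = 0..<n. (f(k := g)) i (p i)) = g (p k) * (\<Prod>i \<in> {0..<n} - {k}. f i (p i))" for p g
    using assms by (subst prod.remove[of _ k]) (auto intro!: prod.cong)
  show ?thesis
    unfolding fdet_eq_sum * by (simp add: sum_distrib_left sum.distrib[symmetric] algebra_simps)
qed

lemma fdet_identical_rows:
  assumes "k < n" "l < n" "k \<noteq> l" "\<And>j. j < n \<Longrightarrow> f k j = f l j"
  shows "fdet n f = 0"
  unfolding fdet_def using assms
  by (intro det_identical_rows[of _ n k l]) auto

lemma fdet_scale_rows: "fdet n (\<lambda>i j. c i * f i j) = (\<Prod>i<n. c i) * fdet n f"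
  unfolding fdet_eq_sum
  by (simp add: prod.distrib sum_distrib_left atLeast0LessThan mult.left_commute)

lemma fdet_scale_cols: "fdet n (\<lambda>i j. c j * f i j) = (\<Prod>j<n. c j) * fdet n f"
  using fdet_scale_rows[of n c "\<lambda>i j. f j i"] fdet_transpose[of n f]
    fdet_transpose[of n "\<lambda>i j. c i * f j i"] by simp

lemma fdet_permute_rows:
  assumes "p permutes {0..<n}"
  shows "fdet n (\<lambda>i. f (p i)) = signof p * fdet n f"
proof -
  have "mat n n (\<lambda>(i, j). f (p i) j) = mat n n (\<lambda>(i, j). mat n n (\<lambda>(i, j). f i j) $$ (p i, j))"
    using permutes_in_image[OF assms] by (intro eq_matI) auto
  then show ?thesis
    unfolding fdet_def using det_permute_rows[of "mat n n (\<lambda>(i, j). f i j)" n p] assms by simp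
qed

lemma fdet_last_row_unit:
  assumes "\<And>j. j \<le> n \<Longrightarrow> f n j = (if j = n then 1 else 0)"
  shows "fdet (Suc n) f = fdet n f"
proof -
  let ?A = "mat (Suc n) (Suc n) (\<lambda>(i, j). f i j)"
  have "det ?A = (\<Sum>j<Suc n. ?A $$ (n, j) * cofactor ?A n j)"
    by (rule laplace_expansion_row) auto
  also have "\<dots> = cofactor ?A n n"
    using assms by simp
  also have "\<dots> = det (mat_delete ?A n n)"
    by (simp add: cofactor_def)
  also have "mat_delete ?A n n = mat n n (\<lambda>(i, j). f i j)"
    by (rule eq_matI) (auto simp: mat_delete_def)
  finally show ?thesis by (simp add: fdet_def)
qed

text \<open>With a left inverse \<open>B\<close> of the matrix, the row of coefficients is
  \<open>x\<close> times \<open>B\<close>.\<close>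

lemma fdet_nonzero_spans:
  fixes f :: "nat \<Rightarrow> nat \<Rightarrow> 'a::field"
  assumes "fdet n f \<noteq> 0"
  obtains c where "\<And>j. j < n \<Longrightarrow> x j = (\<Sum>i<n. c i * f i j)"
proof -
  let ?A = "mat n n (\<lambda>(i, j). f i j)"
  have A: "?A \<in> carrier_mat n n" by simp
  then obtain B where B: "B \<in> carrier_mat n n" "B * ?A = 1\<^sub>m n"
    using det_non_zero_imp_unit[OF A, where b = "()"] assms
    unfolding fdet_def Units_def by (auto simp: ring_mat_def)
  define c where "c = (\<lambda>i. \<Sum>k<n. x k * B $$ (k, i))"
  have "x j = (\<Sum>i<n. c i * f i j)" if j: "j < n" for j
  proof -
    have "(\<Sum>i<n. c i * f i j) = (\<Sum>k<n. x k * (\<Sum>i<n. B $$ (k, i) * f i j))"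
      unfolding c_def sum_distrib_right sum_distrib_left
      by (subst sum.swap) (simp add: mult.assoc)
    also have "\<dots> = (\<Sum>k<n. x k * (B * ?A) $$ (k, j))"
      using j B(1) by (intro sum.cong) (auto simp: scalar_prod_def atLeast0LessThan)
    also have "\<dots> = x j"
      unfolding B(2) using j by (simp add: if_distrib[of "\<lambda>y. _ * y"] cong: if_cong)
    finally show ?thesis by simp
  qed
  then show thesis by (rule that)
qed


section \<open>The three-term Pluecker relation\<close>

lemma fdet_row_sum:
  assumes "k < n" "finite S"
  shows "fdet n (f(k := \<lambda>j. \<Sum>i\<in>S. c i * g i j)) = (\<Sum>i\<in>S. c i * fdet n (f(k := g i)))"
  using assms(2)
proof induction
  case empty
  show ?case using fdet_row_linear[OF assms(1), of f 0 "\<lambda>_. 0" 0 "\<lambda>_. 0"] by (simp add: fun_upd_def)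
next
  case (insert x S)
  then show ?case
    using fdet_row_linear[OF assms(1), of f "c x" "g x" 1 "\<lambda>j. \<Sum>i\<in>S. c i * g i j"]
    by (simp add: fun_upd_def)
qed

lemma fdet_swap_rows:
  assumes "k < n" "l < n" "k \<noteq> l"
  shows "fdet n (f(k := a, l := b)) = - fdet n (f(k := b, l := a))"
proof -
  let ?p = "Transposition.transpose k l"
  have "?p permutes {0..<n}"
    using assms by (intro permutes_swap_id) auto
  moreover have "(\<lambda>i. (f(k := b, l := a)) (?p i)) = f(k := a, l := b)"
    using assms by (auto simp: Transposition.transpose_def)
  ultimately show ?thesis
    using fdet_permute_rows[of ?p n "f(k := b, l := a)"] assms by (simp add: sign_swap_id)
qed

text \<open>The cycle \<open>0 -> 1 -> ... -> n -> 0\<close>, fixing everything beyond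
  \<open>n\<close>. Composing with it moves entry 0 to position \<open>n\<close>; it serves for rows
  first and for coordinates later.\<close>

definition cyc :: "nat \<Rightarrow> nat \<Rightarrow> nat" where
  "cyc n i = (if i < n then Suc i else if i = n then 0 else i)"

lemma cyc_permutes: "n < m \<Longrightarrow> cyc n permutes {0..<m}"
  by (rule inj_imp_permutes) (auto simp: cyc_def inj_on_def split: if_splits)

text \<open>\<open>P\<close> and \<open>Q\<close> share the rows \<open>v 1, ..., v n\<close>, and
  \<open>P\<close> also contains \<open>v 0\<close>. If \<open>P x\<close> is nonzero,
  \<open>v 0, ..., v n, x\<close> is a basis, and since the relation is linear in \<open>y\<close>,
  it suffices to check it for basis vectors. By symmetry only the trivial case remains in which
  \<open>P\<close> vanishes on all three vectors.\<close>

lemma fdet_pluecker: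
  fixes n :: nat and v :: "nat \<Rightarrow> nat \<Rightarrow> 'a::field"
  defines "P \<equiv> \<lambda>b. fdet (Suc (Suc n)) (v(Suc n := b))"
    and "Q \<equiv> \<lambda>a b. fdet (Suc (Suc n)) ((\<lambda>i. v (Suc i))(n := a, Suc n := b))"
  shows "P x * Q y z - P y * Q x z + P z * Q x y = 0"
proof -
  have Q_swap: "Q a b = - Q b a" for a b
    unfolding Q_def by (rule fdet_swap_rows) auto
  have Q_same: "Q a a = 0" for a
    unfolding Q_def by (rule fdet_identical_rows[of n _ "Suc n"]) auto
  have P_v: "P (v i) = 0" if "i \<le> n" for i
    unfolding P_def using that by (intro fdet_identical_rows[of i _ "Suc n"]) auto
  have Q_v: "Q a (v (Suc i)) = 0" if "i < n" for a i
    unfolding Q_def using that by (intro fdet_identical_rows[of i _ "Suc n"]) auto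
  \<comment> \<open>The cycle carries \<open>v 0\<close> behind \<open>v n\<close>, which is the
    place of the first argument of \<open>Q\<close>.\<close>
  have Q_v0: "Q (v 0) b = of_int (sign (cyc n)) * P b" for b
  proof -
    have "(\<lambda>i. (v(Suc n := b)) (cyc n i)) i = ((\<lambda>i. v (Suc i))(n := v 0, Suc n := b)) i"
      if "i < Suc (Suc n)" for i
      using that by (auto simp: cyc_def)
    then show ?thesis
      unfolding P_def Q_def by (subst fdet_permute_rows[symmetric, OF cyc_permutes]) (auto intro!: fdet_cong)
  qed
  have *: "P x * Q y z - P y * Q x z + P z * Q x y = 0" if nz: "P x \<noteq> 0" for x y z
  proof -
    let ?b = "v(Suc n := x)"
    obtain c where c: "\<And>j. j < Suc (Suc n) \<Longrightarrow> y j = (\<Sum>i<Suc (Suc n). c i * ?b i j)"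
      using fdet_nonzero_spans[of "Suc (Suc n)" ?b y] nz unfolding P_def by blast
    have P_y: "P y = (\<Sum>i<Suc (Suc n). c i * P (?b i))"
      unfolding P_def by (subst fdet_row_sum[symmetric]) (auto intro!: fdet_cong simp: c)
    have Q_y: "Q a y = (\<Sum>i<Suc (Suc n). c i * Q a (?b i))" for a
      unfolding Q_def by (subst fdet_row_sum[symmetric]) (auto intro!: fdet_cong simp: c)
    \<comment> \<open>The expanded vector is kept in the last row of \<open>Q\<close>; antisymmetry
      restores the stated order afterwards.\<close>
    have "P x * Q z (?b i) + P (?b i) * Q x z - P z * Q x (?b i) = 0" if i: "i < Suc (Suc n)" for i
    proof -
      consider "i = 0" | k where "i = Suc k" "k < n" | "i = Suc n"
        using i by (cases i) (auto simp: less_Suc_eq)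
      then show ?thesis
      proof cases
        case 1
        then show ?thesis
          using P_v[of 0] Q_v0[of z] Q_v0[of x] Q_swap[of z "v 0"] Q_swap[of x "v 0"] by simp
      next
        case 2
        then show ?thesis using P_v[of i] Q_v by simp
      next
        case 3
        then show ?thesis using Q_same[of x] Q_swap[of x z] by simp
      qed
    qed
    then have "(\<Sum>i<Suc (Suc n). c i * (P x * Q z (?b i) + P (?b i) * Q x z - P z * Q x (?b i))) = 0"
      by (intro sum.neutral) auto
    then have "P x * Q z y + P y * Q x z - P z * Q x y = 0"
      unfolding P_y Q_y
      by (simp only: sum_distrib_left sum_distrib_right sum.distrib[symmetric] sum_subtractf[symmetric])
         (simp add: algebra_simps)
    then show ?thesis using Q_swap[of y z] by (simp add: algebra_simps)
  qed
  consider "P x \<noteq> 0" | "P y \<noteq> 0" | "P z \<noteq> 0" | "P x = 0" "P y = 0" "P z = 0" by blast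
  then show ?thesis
  proof cases
    case 1
    then show ?thesis by (rule *)
  next
    case 2
    then show ?thesis using *[OF 2, of x z] Q_swap[of x y] by (simp add: algebra_simps)
  next
    case 3
    then show ?thesis using *[OF 3, of x y] Q_swap[of z y] Q_swap[of z x] by (simp add: algebra_simps)
  qed simp
qed

section \<open>Determinants of chains and their three-term identities\<close>

lemma fdet_chain:
  assumes "k < n" "\<And>i j. i < k \<Longrightarrow> j < n \<Longrightarrow> f i j = a i * f (Suc i) j + c i * z i j"
  shows "fdet n f = (\<Prod>i<k. c i) * fdet n (\<lambda>i. if i < k then z i else f i)"
  using assms
proof (induction k)
  case 0
  then show ?case by simp
next
  case (Suc k)
  let ?g = "\<lambda>i. if i < k then z i else f i"
  have "fdet n ?g = fdet n (?g(k := \<lambda>j. a k * f (Suc k) j + c k * z k j))"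
    using Suc.prems by (intro fdet_cong) auto
  also have "\<dots> = a k * fdet n (?g(k := f (Suc k))) + c k * fdet n (?g(k := z k))"
    using Suc.prems by (intro fdet_row_linear) auto
  \<comment> \<open>Only rows before \<open>k\<close> have been replaced so far, so rows
    \<open>k\<close> and \<open>k + 1\<close> coincide.\<close>
  also have "fdet n (?g(k := f (Suc k))) = 0"
    using Suc.prems by (intro fdet_identical_rows[of k _ "Suc k"]) auto
  also have "?g(k := z k) = (\<lambda>i. if i < Suc k then z i else f i)"
    by auto
  finally show ?case using Suc by (simp add: mult.assoc)
qed


lemma fdet_Suc_0: "fdet (Suc 0) f = f 0 0"
  by (simp add: fdet_def det_single)

text \<open>The chains reduce \<open>w\<close> and the scaled \<open>s\<close> to the common rows
  \<open>\<kappa> i * z k i\<close> and one last row, and \<open>p\<close> to rows of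
  \<open>w\<close>. The claim becomes the Pluecker relation for \<open>w N\<close>, the scaled
  \<open>s N\<close> and a unit vector. Scaling brings in the product of the
  \<open>\<kappa> i\<close> with \<open>i < N\<close>, which is cancelled at the end and so must not
  vanish.\<close>

lemma fdet_three_term_nonzero:
  fixes w s z p :: "nat \<Rightarrow> nat \<Rightarrow> 'a::field"
  assumes w: "\<And>k i. k < N \<Longrightarrow> i \<le> N \<Longrightarrow> w k i = a k * w (Suc k) i + \<alpha> k * (\<kappa> i * z k i)"
    and s: "\<And>k i. k < N \<Longrightarrow> i \<le> N \<Longrightarrow> s k i = b k * s (Suc k) i + \<beta> k * z k i"
    and p: "\<And>k i. k < N \<Longrightarrow> i \<le> N \<Longrightarrow> p k i = v k * p (Suc k) i + u k * w (Suc k) i"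
    and pN: "\<And>i. i \<le> N \<Longrightarrow> c * p N i = l * w N i + m * (\<kappa> i * s N i)"
    and N0: "N = 0 \<Longrightarrow> \<alpha> 0 * l + \<beta> 0 * m = 0"
    and \<kappa>: "\<And>i. i < N \<Longrightarrow> \<kappa> i \<noteq> 0"
  shows "(\<Prod>k<N. u k) * m * (\<beta> 0 * fdet (Suc N) w * fdet N (\<lambda>k. s (Suc k))
      - \<alpha> 0 * \<kappa> N * fdet (Suc N) s * fdet N (\<lambda>k. w (Suc k)))
    + \<alpha> 0 * (\<Prod>k<N. \<beta> k) * c * fdet N z * fdet (Suc N) p = 0"
proof (cases N)
  case 0
  \<comment> \<open>For \<open>N = 0\<close> no chain equation ties \<open>\<alpha> 0\<close> and
    \<open>\<beta> 0\<close> to the vectors; \<open>N0\<close> makes the coefficient of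
    \<open>w 0 0\<close> vanish.\<close>
  have "\<alpha> 0 * (c * p 0 0) = \<alpha> 0 * l * w 0 0 + \<alpha> 0 * m * (\<kappa> 0 * s 0 0)"
    using pN[of 0] 0 by (simp add: algebra_simps)
  then have "m * (\<beta> 0 * w 0 0 - \<alpha> 0 * \<kappa> 0 * s 0 0) + \<alpha> 0 * (c * p 0 0)
      = (\<alpha> 0 * l + \<beta> 0 * m) * w 0 0"
    by (simp add: algebra_simps)
  then show ?thesis
    using 0 N0 by (simp add: fdet_Suc_0 mult.assoc)
next
  case (Suc n)
  \<comment> \<open>Bordering by \<open>e\<close> raises the determinants of size \<open>N\<close>
    to size \<open>N + 1\<close>.\<close>
  define e :: "nat \<Rightarrow> 'a" where "e = (\<lambda>j. if j = N then 1 else 0)"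
  define K where "K = (\<lambda>x i. \<kappa> i * x i :: 'a)"
  define v' where "v' = (\<lambda>k. K (z k))"
  define P where "P = (\<lambda>b. fdet (Suc (Suc n)) (v'(Suc n := b)))"
  define Q where "Q = (\<lambda>a b. fdet (Suc (Suc n)) ((\<lambda>i. v' (Suc i))(n := a, Suc n := b)))"
  define A' where "A' = (\<Prod>k<n. \<alpha> (Suc k))"
  define B' where "B' = (\<Prod>k<n. \<beta> (Suc k))"
  define \<kappa>' where "\<kappa>' = (\<Prod>i<N. \<kappa> i)"
  have A: "(\<Prod>k<N. \<alpha> k) = \<alpha> 0 * A'" and B: "(\<Prod>k<N. \<beta> k) = \<beta> 0 * B'"
    unfolding Suc A'_def B'_def by (rule prod.lessThan_Suc_shift)+
  have drop: "fdet N f = fdet (Suc N) (f(N := e))" for f :: "nat \<Rightarrow> nat \<Rightarrow> 'a"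
    by (subst fdet_last_row_unit) (auto simp: e_def intro!: fdet_cong)
  have m1: "fdet (Suc N) w = \<alpha> 0 * A' * P (w N)"
    unfolding A[symmetric] P_def
    by (subst fdet_chain[of N _ w a \<alpha> v'])
       (auto simp: w v'_def K_def Suc intro!: arg_cong2[where f = "(*)"] fdet_cong)
  have m2: "\<kappa>' * \<kappa> N * fdet (Suc N) s = \<beta> 0 * B' * P (K (s N))"
  proof -
    have "\<kappa>' * \<kappa> N * fdet (Suc N) s = fdet (Suc N) (\<lambda>k. K (s k))"
      unfolding K_def fdet_scale_cols by (simp add: \<kappa>'_def)
    also have "\<dots> = \<beta> 0 * B' * P (K (s N))"
      unfolding B[symmetric] P_def
      by (subst fdet_chain[of N _ "\<lambda>k. K (s k)" b \<beta> v'])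
         (auto simp: s v'_def K_def Suc algebra_simps intro!: arg_cong2[where f = "(*)"] fdet_cong)
    finally show ?thesis .
  qed
  have n1: "fdet N (\<lambda>k. w (Suc k)) = A' * Q (w N) e"
    unfolding drop A'_def Q_def
    by (subst fdet_chain[of n _ _ "\<lambda>k. a (Suc k)" "\<lambda>k. \<alpha> (Suc k)" "\<lambda>k. v' (Suc k)"])
       (auto simp: w v'_def K_def Suc intro!: arg_cong2[where f = "(*)"] fdet_cong)
  have n2: "\<kappa>' * fdet N (\<lambda>k. s (Suc k)) = B' * Q (K (s N)) e"
  proof -
    have "\<kappa>' * fdet N (\<lambda>k. s (Suc k)) = fdet N (\<lambda>k. K (s (Suc k)))"
      unfolding K_def fdet_scale_cols by (simp add: \<kappa>'_def)
    also have "\<dots> = B' * Q (K (s N)) e"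
      unfolding drop B'_def Q_def
      by (subst fdet_chain[of n _ _ "\<lambda>k. b (Suc k)" "\<lambda>k. \<beta> (Suc k)" "\<lambda>k. v' (Suc k)"])
         (auto simp: s v'_def K_def Suc algebra_simps intro!: arg_cong2[where f = "(*)"] fdet_cong)
    finally show ?thesis .
  qed
  have n3: "\<kappa>' * fdet N z = P e"
  proof -
    have "\<kappa>' * fdet N z = fdet N v'"
      unfolding v'_def K_def fdet_scale_cols by (simp add: \<kappa>'_def)
    then show ?thesis unfolding drop P_def by (simp add: Suc)
  qed
  have pp: "c * fdet (Suc N) p = (\<Prod>k<N. u k) * (m * (A' * Q (w N) (K (s N))))"
  proof -
    let ?w = "\<lambda>k. w (Suc k)"
    have "fdet (Suc N) p = (\<Prod>k<N. u k) * fdet (Suc N) (?w(N := p N))"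
      by (subst fdet_chain[of N _ p v u ?w])
         (auto simp: p intro!: arg_cong2[where f = "(*)"] fdet_cong)
    moreover have "c * fdet (Suc N) (?w(N := p N)) = fdet (Suc N) (?w(N := \<lambda>j. c * p N j + 0 * p N j))"
      by (subst fdet_row_linear) auto
    moreover have "\<dots> = fdet (Suc N) (?w(N := \<lambda>j. l * w N j + m * K (s N) j))"
      by (rule fdet_cong) (auto simp: pN K_def)
    moreover have "\<dots> = l * fdet (Suc N) (?w(N := w N)) + m * fdet (Suc N) (?w(N := K (s N)))"
      by (rule fdet_row_linear) simp
    \<comment> \<open>For \<open>N > 0\<close> the vector \<open>w N\<close> is already the
      preceding row, so \<open>l\<close> drops out.\<close>
    moreover have "fdet (Suc N) (?w(N := w N)) = 0"
      by (rule fdet_identical_rows[of n _ N]) (auto simp: Suc)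
    moreover have "fdet (Suc N) (?w(N := K (s N))) = A' * Q (w N) (K (s N))"
      unfolding A'_def Q_def
      by (subst fdet_chain[of n _ _ "\<lambda>k. a (Suc k)" "\<lambda>k. \<alpha> (Suc k)" "\<lambda>k. v' (Suc k)"])
         (auto simp: w v'_def K_def Suc intro!: arg_cong2[where f = "(*)"] fdet_cong)
    ultimately show ?thesis by (simp add: mult.left_commute)
  qed
  have plu: "P (w N) * Q (K (s N)) e - P (K (s N)) * Q (w N) e + P e * Q (w N) (K (s N)) = 0"
    unfolding P_def Q_def by (rule fdet_pluecker)
  define U where "U = (\<Prod>k<N. u k)"
  have "\<kappa>' * (U * m * (\<beta> 0 * fdet (Suc N) w * fdet N (\<lambda>k. s (Suc k))
      - \<alpha> 0 * \<kappa> N * fdet (Suc N) s * fdet N (\<lambda>k. w (Suc k)))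
    + \<alpha> 0 * (\<Prod>k<N. \<beta> k) * c * fdet N z * fdet (Suc N) p)
    = U * m * (\<beta> 0 * fdet (Suc N) w * (\<kappa>' * fdet N (\<lambda>k. s (Suc k)))
      - \<alpha> 0 * (\<kappa>' * \<kappa> N * fdet (Suc N) s) * fdet N (\<lambda>k. w (Suc k)))
    + \<alpha> 0 * (\<Prod>k<N. \<beta> k) * (\<kappa>' * fdet N z) * (c * fdet (Suc N) p)"
    by (simp add: algebra_simps)
  also have "\<dots> = U * m * \<alpha> 0 * \<beta> 0 * A' * B' *
      (P (w N) * Q (K (s N)) e - P (K (s N)) * Q (w N) e + P e * Q (w N) (K (s N)))"
    unfolding m1 m2 n1 n2 n3 pp B U_def[symmetric] by (simp add: algebra_simps)
  also have "\<dots> = 0" unfolding plu by simp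
  finally show ?thesis
    using \<kappa> unfolding U_def by (simp add: \<kappa>'_def)
qed

lemma isCont_fdet:
  fixes f :: "complex \<Rightarrow> nat \<Rightarrow> nat \<Rightarrow> complex"
  assumes "\<And>i j. isCont (\<lambda>x. f x i j) a"
  shows "isCont (\<lambda>x. fdet n (f x)) a"
  unfolding fdet_eq_sum by (intro continuous_intros assms)

lemma backward_recursion_exists:
  fixes F :: "nat \<Rightarrow> 'b \<Rightarrow> 'b"
  obtains d where "d N = d0" "\<And>k. k < N \<Longrightarrow> d k = F k (d (Suc k))"
proof -
  define g where "g = rec_nat d0 (\<lambda>n. F (N - Suc n))"
  have "g (N - k) = F k (g (N - Suc k))" if "k < N" for k
    using that by (simp add: g_def flip: Suc_diff_Suc)
  then show thesis
    by (intro that[of "\<lambda>k. g (N - k)"]) (simp_all add: g_def)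
qed

text \<open>
  For \<open>c = 1\<close> the vectors \<open>w\<close> and \<open>p\<close> are affine functions of \<open>\<kappa>\<close> once \<open>w N\<close>, \<open>s\<close>, \<open>z\<close> are fixed. Replacing \<open>\<kappa>\<close>
  by \<open>\<kappa> + x\<close> with \<open>x \<rightarrow> 0\<close> removes the hypothesis that \<open>\<kappa>\<close> has no zeros.
\<close>

lemma fdet_three_term:
  fixes w s z p :: "nat \<Rightarrow> nat \<Rightarrow> complex"
  assumes w: "\<And>k i. k < N \<Longrightarrow> i \<le> N \<Longrightarrow> w k i = a k * w (Suc k) i + \<alpha> k * (\<kappa> i * z k i)"
    and s: "\<And>k i. k < N \<Longrightarrow> i \<le> N \<Longrightarrow> s k i = b k * s (Suc k) i + \<beta> k * z k i"
    and p: "\<And>k i. k < N \<Longrightarrow> i \<le> N \<Longrightarrow> p k i = v k * p (Suc k) i + u k * w (Suc k) i"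
    and pN: "\<And>i. i \<le> N \<Longrightarrow> c * p N i = l * w N i + m * (\<kappa> i * s N i)"
    and N0: "N = 0 \<Longrightarrow> \<alpha> 0 * l + \<beta> 0 * m = 0"
    and c: "c = 1 \<or> (\<forall>i<N. \<kappa> i \<noteq> 0)"
  shows "(\<Prod>k<N. u k) * m * (\<beta> 0 * fdet (Suc N) w * fdet N (\<lambda>k. s (Suc k))
      - \<alpha> 0 * \<kappa> N * fdet (Suc N) s * fdet N (\<lambda>k. w (Suc k)))
    + \<alpha> 0 * (\<Prod>k<N. \<beta> k) * c * fdet N z * fdet (Suc N) p = 0"
proof (cases "c = 1")
  case False
  with c have "\<kappa> i \<noteq> 0" if "i < N" for i using that by simp
  with w s p pN N0 show ?thesis by (rule fdet_three_term_nonzero)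
next
  case True
  \<comment> \<open>\<open>dw\<close> and \<open>dp\<close> are the slopes of \<open>w\<close> and
    \<open>p\<close> when \<open>\<kappa>\<close> becomes \<open>\<kappa> + x\<close>. They start
    from 0 because \<open>w N\<close> is kept, and from \<open>m * s N\<close> because the closing
    equation with \<open>c = 1\<close> determines \<open>p N\<close>.\<close>
  obtain dw :: "nat \<Rightarrow> nat \<Rightarrow> complex" where dw: "dw N = (\<lambda>i. 0)"
      "\<And>k. k < N \<Longrightarrow> dw k = (\<lambda>i. a k * dw (Suc k) i + \<alpha> k * z k i)"
    using backward_recursion_exists[of N "\<lambda>i. 0" "\<lambda>k d i. a k * d i + \<alpha> k * z k i"] by metis
  obtain dp :: "nat \<Rightarrow> nat \<Rightarrow> complex" where dp: "dp N = (\<lambda>i. m * s N i)"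
      "\<And>k. k < N \<Longrightarrow> dp k = (\<lambda>i. v k * dp (Suc k) i + u k * dw (Suc k) i)"
    using backward_recursion_exists[of N "\<lambda>i. m * s N i" "\<lambda>k d i. v k * d i + u k * dw (Suc k) i"]
    by metis
  define w' where "w' = (\<lambda>x k i. w k i + x * dw k i)"
  define p' where "p' = (\<lambda>x k i. p k i + x * dp k i)"
  define \<Phi> where "\<Phi> = (\<lambda>x. (\<Prod>k<N. u k) * m * (\<beta> 0 * fdet (Suc N) (w' x) * fdet N (\<lambda>k. s (Suc k))
      - \<alpha> 0 * (\<kappa> N + x) * fdet (Suc N) s * fdet N (\<lambda>k. w' x (Suc k)))
    + \<alpha> 0 * (\<Prod>k<N. \<beta> k) * c * fdet N z * fdet (Suc N) (p' x))"
  have zero: "\<Phi> x = 0" if "x \<notin> (\<lambda>i. - \<kappa> i) ` {..<N}" for x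
  proof -
    have "\<kappa> i + x \<noteq> 0" if "i < N" for i
      using \<open>x \<notin> _\<close> that by (metis (full_types) add.commute add_eq_0_iff imageI lessThan_iff)
    then show ?thesis
      unfolding \<Phi>_def using N0 pN[unfolded True]
      by (intro fdet_three_term_nonzero[of N "w' x" a \<alpha> "\<lambda>i. \<kappa> i + x" z s b \<beta> "p' x" v u c l m])
         (simp_all add: True w'_def p'_def w s p dw dp algebra_simps)
  qed
  have "isCont \<Phi> 0"
    unfolding \<Phi>_def w'_def p'_def by (intro continuous_intros isCont_fdet)
  then have "(\<Phi> \<longlongrightarrow> \<Phi> 0) (at 0)" by (simp add: isCont_def)
  moreover have "eventually (\<lambda>x. \<Phi> x = 0) (at 0)"
  proof -
    \<comment> \<open>Only finitely many \<open>x\<close> make some \<open>\<kappa> i + x\<close>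
      zero; the point 0 is exempted because the limit ignores it.\<close>
    have "open (- ((\<lambda>i. - \<kappa> i) ` {..<N} - {0}))"
      by (intro open_Compl finite_imp_closed) auto
    then have "eventually (\<lambda>x. x \<in> - ((\<lambda>i. - \<kappa> i) ` {..<N} - {0})) (nhds 0)"
      by (rule eventually_nhds_in_open) auto
    then show ?thesis
      unfolding eventually_at_filter by eventually_elim (auto intro: zero)
  qed
  then have "(\<Phi> \<longlongrightarrow> 0) (at 0)"
    by (rule tendsto_eventually)
  ultimately have "\<Phi> 0 = 0"
    by (rule tendsto_unique[rotated]) simp
  then show ?thesis by (simp add: \<Phi>_def w'_def p'_def)
qed

section \<open>Three-term identities with other choices of minors\<close>

lemma fdet_permute_cols:
  assumes "p permutes {0..<n}"
  shows "fdet n (\<lambda>i j. f i (p j)) = of_int (sign p) * fdet n f"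
  using fdet_permute_rows[OF assms, of "\<lambda>i j. f j i"] fdet_transpose[of n f]
    fdet_transpose[of n "\<lambda>i j. f j (p i)"] by simp

text \<open>Cycling the coordinates makes coordinate 0 the last, hence the omitted one. Every
  product contains exactly one determinant of size \<open>N + 1\<close>, so the sign of the cycle
  cancels. For lattice vectors, omitting the first coordinate shifts a parameter of the smaller
  determinants by \<open>q\<close>.\<close>

lemma fdet_three_term_drop_first:
  fixes w s z p :: "nat \<Rightarrow> nat \<Rightarrow> complex"
  assumes w: "\<And>k i. k < N \<Longrightarrow> i \<le> N \<Longrightarrow> w k i = a k * w (Suc k) i + \<alpha> k * (\<kappa> i * z k i)"
    and s: "\<And>k i. k < N \<Longrightarrow> i \<le> N \<Longrightarrow> s k i = b k * s (Suc k) i + \<beta> k * z k i"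
    and p: "\<And>k i. k < N \<Longrightarrow> i \<le> N \<Longrightarrow> p k i = v k * p (Suc k) i + u k * w (Suc k) i"
    and pN: "\<And>i. i \<le> N \<Longrightarrow> c * p N i = l * w N i + m * (\<kappa> i * s N i)"
    and N0: "N = 0 \<Longrightarrow> \<alpha> 0 * l + \<beta> 0 * m = 0"
    and \<kappa>: "\<forall>i\<le>N. \<kappa> i \<noteq> 0"
  shows "(\<Prod>k<N. u k) * m * (\<beta> 0 * fdet (Suc N) w * fdet N (\<lambda>k i. s (Suc k) (Suc i))
      - \<alpha> 0 * \<kappa> 0 * fdet (Suc N) s * fdet N (\<lambda>k i. w (Suc k) (Suc i)))
    + \<alpha> 0 * (\<Prod>k<N. \<beta> k) * c * fdet N (\<lambda>k i. z k (Suc i)) * fdet (Suc N) p = 0"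
proof -
  define \<sigma> :: complex where "\<sigma> = of_int (sign (cyc N))"
  have \<sigma>: "\<sigma> \<noteq> 0" by (simp add: \<sigma>_def sign_nz)
  have cyc_same: "cyc N N = 0" by (simp add: cyc_def)
  have le: "cyc N i \<le> N" if "i \<le> N" for i using that by (auto simp: cyc_def)
  have main: "(\<Prod>k<N. u k) * m * (\<beta> 0 * fdet (Suc N) (\<lambda>k i. w k (cyc N i)) * fdet N (\<lambda>k i. s (Suc k) (cyc N i))
      - \<alpha> 0 * \<kappa> (cyc N N) * fdet (Suc N) (\<lambda>k i. s k (cyc N i)) * fdet N (\<lambda>k i. w (Suc k) (cyc N i)))
    + \<alpha> 0 * (\<Prod>k<N. \<beta> k) * c * fdet N (\<lambda>k i. z k (cyc N i)) * fdet (Suc N) (\<lambda>k i. p k (cyc N i)) = 0"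
  proof (rule fdet_three_term[where a = a and b = b and v = v and l = l and \<kappa> = "\<lambda>i. \<kappa> (cyc N i)"])
    show "c = 1 \<or> (\<forall>i<N. \<kappa> (cyc N i) \<noteq> 0)"
      using \<kappa> le by (meson less_imp_le)
  qed (rule w[OF _ le] s[OF _ le] p[OF _ le] pN[OF le] N0; assumption)+
  have full: "fdet (Suc N) (\<lambda>k i. f k (cyc N i)) = \<sigma> * fdet (Suc N) f" for f :: "nat \<Rightarrow> nat \<Rightarrow> complex"
    unfolding \<sigma>_def by (intro fdet_permute_cols cyc_permutes) simp
  have part: "fdet N (\<lambda>k i. f k (cyc N i)) = fdet N (\<lambda>k i. f k (Suc i))" for f :: "nat \<Rightarrow> nat \<Rightarrow> complex"
    by (rule fdet_cong) (auto simp: cyc_def)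
  have "\<sigma> * ((\<Prod>k<N. u k) * m * (\<beta> 0 * fdet (Suc N) w * fdet N (\<lambda>k i. s (Suc k) (Suc i))
      - \<alpha> 0 * \<kappa> 0 * fdet (Suc N) s * fdet N (\<lambda>k i. w (Suc k) (Suc i)))
    + \<alpha> 0 * (\<Prod>k<N. \<beta> k) * c * fdet N (\<lambda>k i. z k (Suc i)) * fdet (Suc N) p) = 0"
    using main unfolding full part[of "\<lambda>k. s (Suc k)"] part[of "\<lambda>k. w (Suc k)"] part[of z] cyc_same
    by (simp add: algebra_simps)
  with \<sigma> show ?thesis by simp
qed

text \<open>The original columns form a chain over the modified ones, with coefficients
  \<open>- \<theta> i\<close> and 1.\<close>

lemma fdet_unitriangular_cols:
  "fdet (Suc N) (\<lambda>k i. if i < N then f k i + \<theta> i * f k (Suc i) else f k i) = fdet (Suc N) f"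
proof -
  have "fdet (Suc N) (\<lambda>i k. f k i) = (\<Prod>i<N. 1) *
      fdet (Suc N) (\<lambda>i. if i < N then (\<lambda>k. f k i + \<theta> i * f k (Suc i)) else (\<lambda>k. f k i))"
    by (rule fdet_chain[where a = "\<lambda>i. - \<theta> i"]) auto
  also have "\<dots> = fdet (Suc N) (\<lambda>i k. if i < N then f k i + \<theta> i * f k (Suc i) else f k i)"
    by (auto intro!: fdet_cong)
  also have "\<dots> = fdet (Suc N) (\<lambda>k i. if i < N then f k i + \<theta> i * f k (Suc i) else f k i)"
    by (rule fdet_transpose)
  finally show ?thesis using fdet_transpose[of "Suc N" f] by simp
qed

text \<open>
  A unitriangular change of coordinates leaves the determinants of size \<open>N + 1\<close> alone but alters which hyperplane the
  determinants of size \<open>N\<close> see; this shifts \<open>t\<close> in them.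
\<close>

lemma fdet_three_term_twisted:
  fixes w s z p :: "nat \<Rightarrow> nat \<Rightarrow> complex"
  assumes w: "\<And>k i. k < N \<Longrightarrow> i \<le> N \<Longrightarrow> w k i = a k * w (Suc k) i + \<alpha> k * (\<kappa> i * z k i)"
    and s: "\<And>k i. k < N \<Longrightarrow> i \<le> N \<Longrightarrow> s k i = b k * s (Suc k) i + \<beta> k * z k i"
    and p: "\<And>k i. k < N \<Longrightarrow> i \<le> N \<Longrightarrow> p k i = v k * p (Suc k) i + u k * w (Suc k) i"
    and pN: "\<And>i. i \<le> N \<Longrightarrow> c * p N i = l * w N i + m * (\<kappa> i * s N i)"
    and N0: "N = 0 \<Longrightarrow> \<alpha> 0 * l + \<beta> 0 * m = 0"
    and c: "c = 1 \<or> (\<forall>i<N. \<kappa> i \<noteq> 0)"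
    and \<theta>: "\<And>i. i < N \<Longrightarrow> \<theta> i * \<kappa> (Suc i) = \<kappa> i * \<eta> i"
  shows "(\<Prod>k<N. u k) * m * (\<beta> 0 * fdet (Suc N) w * fdet N (\<lambda>k i. s (Suc k) i + \<eta> i * s (Suc k) (Suc i))
      - \<alpha> 0 * \<kappa> N * fdet (Suc N) s * fdet N (\<lambda>k i. w (Suc k) i + \<theta> i * w (Suc k) (Suc i)))
    + \<alpha> 0 * (\<Prod>k<N. \<beta> k) * c * fdet N (\<lambda>k i. z k i + \<eta> i * z k (Suc i)) * fdet (Suc N) p = 0"
proof -
  define tw where "tw = (\<lambda>\<theta> (f :: nat \<Rightarrow> nat \<Rightarrow> complex) k i. if i < N then f k i + \<theta> i * f k (Suc i) else f k i)"
  \<comment> \<open>Multiplication by \<open>\<kappa>\<close> turns the \<open>\<eta>\<close>-twist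
    into the \<open>\<theta>\<close>-twist. Hence \<open>w\<close>, \<open>p\<close> twisted by
    \<open>\<theta>\<close> and \<open>s\<close>, \<open>z\<close> twisted by \<open>\<eta>\<close>
    satisfy the original equations.\<close>
  have \<theta>': "\<kappa> i * (\<eta> i * x) = \<theta> i * (\<kappa> (Suc i) * x)" if "i < N" for i x
    using \<theta>[OF that] by (metis mult.assoc)
  have main: "(\<Prod>k<N. u k) * m * (\<beta> 0 * fdet (Suc N) (tw \<theta> w) * fdet N (\<lambda>k. tw \<eta> s (Suc k))
      - \<alpha> 0 * \<kappa> N * fdet (Suc N) (tw \<eta> s) * fdet N (\<lambda>k. tw \<theta> w (Suc k)))
    + \<alpha> 0 * (\<Prod>k<N. \<beta> k) * c * fdet N (tw \<eta> z) * fdet (Suc N) (tw \<theta> p) = 0"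
  proof (rule fdet_three_term[where a = a and b = b and v = v and l = l])
    fix k i assume "k < N" "i \<le> N"
    then show "tw \<theta> w k i = a k * tw \<theta> w (Suc k) i + \<alpha> k * (\<kappa> i * tw \<eta> z k i)"
      by (cases "i < N") (simp_all add: tw_def w[of k] ring_distribs \<theta>' mult.left_commute[of _ "\<theta> i"])
    show "tw \<eta> s k i = b k * tw \<eta> s (Suc k) i + \<beta> k * tw \<eta> z k i"
      using \<open>k < N\<close> \<open>i \<le> N\<close> by (cases "i < N") (simp_all add: tw_def s[of k] ring_distribs mult.left_commute[of _ "\<eta> i"])
    show "tw \<theta> p k i = v k * tw \<theta> p (Suc k) i + u k * tw \<theta> w (Suc k) i"
      using \<open>k < N\<close> \<open>i \<le> N\<close> by (cases "i < N") (simp_all add: tw_def p[of k] ring_distribs mult.left_commute[of _ "\<theta> i"])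
  next
    fix i assume "i \<le> N"
    show "c * tw \<theta> p N i = l * tw \<theta> w N i + m * (\<kappa> i * tw \<eta> s N i)"
    proof (cases "i < N")
      case True
      have "c * tw \<theta> p N i = c * p N i + \<theta> i * (c * p N (Suc i))"
        using True by (simp add: tw_def algebra_simps)
      also have "\<dots> = l * tw \<theta> w N i + m * (\<kappa> i * s N i + \<theta> i * (\<kappa> (Suc i) * s N (Suc i)))"
        using True by (simp add: pN tw_def algebra_simps)
      also have "\<kappa> i * s N i + \<theta> i * (\<kappa> (Suc i) * s N (Suc i)) = \<kappa> i * tw \<eta> s N i"
        using True by (simp add: tw_def \<theta>' ring_distribs)
      finally show ?thesis .
    qed (use \<open>i \<le> N\<close> pN in \<open>simp add: tw_def\<close>)
  qed (rule N0 c, assumption?)+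
  have full: "fdet (Suc N) (tw \<theta> f) = fdet (Suc N) f" for \<theta> f
    unfolding tw_def by (rule fdet_unitriangular_cols)
  have part: "fdet N (\<lambda>k. tw \<theta> f (g k)) = fdet N (\<lambda>k i. f (g k) i + \<theta> i * f (g k) (Suc i))" for \<theta> f g
    by (rule fdet_cong) (auto simp: tw_def)
  show ?thesis
    using main unfolding full part[of _ _ Suc] part[of _ z "\<lambda>k. k"] .
qed

text \<open>The case of a single chain: \<open>r\<close> plays \<open>w\<close>, the given
  \<open>s\<close> plays both \<open>s\<close> and \<open>z\<close>, and \<open>p\<close> is
  \<open>r\<close> moved by one index. The chain equation at \<open>N\<close> is the closing
  equation, with \<open>c = a N\<close>, \<open>l = 1\<close>, \<open>m = - d N\<close>. The next
  two lemmas specialise the drop-first and the twisted identity in the same way.\<close>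

lemma fdet_chain_three_term:
  fixes r s :: "nat \<Rightarrow> nat \<Rightarrow> complex"
  assumes r: "\<And>k i. k \<le> N \<Longrightarrow> i \<le> N \<Longrightarrow> r k i = a k * r (Suc k) i + d k * (\<kappa> i * s k i)"
    and \<kappa>: "a N = 1 \<or> (\<forall>i<N. \<kappa> i \<noteq> 0)"
  shows "d N * fdet (Suc N) r * fdet N (\<lambda>k. s (Suc k)) =
    d 0 * d N * \<kappa> N * fdet (Suc N) s * fdet N (\<lambda>k. r (Suc k))
    + d 0 * a N * fdet N (s) * fdet (Suc N) (\<lambda>k. r (Suc k))"
proof -
  have "(\<Prod>k<N. 1) * (- d N) * (1 * fdet (Suc N) r * fdet N (\<lambda>k. s (Suc k))
      - d 0 * \<kappa> N * fdet (Suc N) s * fdet N (\<lambda>k. r (Suc k)))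
    + d 0 * (\<Prod>k<N. 1) * a N * fdet N (s) * fdet (Suc N) (\<lambda>k. r (Suc k)) = 0"
  proof (rule fdet_three_term[where a = a and b = "\<lambda>_. 0" and \<beta> = "\<lambda>_. 1" and v = "\<lambda>_. 0"
      and u = "\<lambda>_. 1" and l = 1 and \<kappa> = \<kappa>], goal_cases)
    case (1 k i)
    then show ?case by (simp add: r)
  next
    case (4 i)
    then show ?case using r[of N i] by simp
  qed (use \<kappa> in simp_all)
  then show ?thesis by (simp add: algebra_simps)
qed

lemma fdet_chain_three_term_drop_first:
  fixes r s :: "nat \<Rightarrow> nat \<Rightarrow> complex"
  assumes r: "\<And>k i. k \<le> N \<Longrightarrow> i \<le> N \<Longrightarrow> r k i = a k * r (Suc k) i + d k * (\<kappa> i * s k i)"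
    and \<kappa>: "\<forall>i\<le>N. \<kappa> i \<noteq> 0"
  shows "d N * fdet (Suc N) r * fdet N (\<lambda>k i. s (Suc k) (Suc i)) =
    d 0 * d N * \<kappa> 0 * fdet (Suc N) s * fdet N (\<lambda>k i. r (Suc k) (Suc i))
    + d 0 * a N * fdet N (\<lambda>k i. s k (Suc i)) * fdet (Suc N) (\<lambda>k. r (Suc k))"
proof -
  have "(\<Prod>k<N. 1) * (- d N) * (1 * fdet (Suc N) r * fdet N (\<lambda>k i. s (Suc k) (Suc i))
      - d 0 * \<kappa> 0 * fdet (Suc N) s * fdet N (\<lambda>k i. r (Suc k) (Suc i)))
    + d 0 * (\<Prod>k<N. 1) * a N * fdet N (\<lambda>k i. s k (Suc i)) * fdet (Suc N) (\<lambda>k. r (Suc k)) = 0"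
  proof (rule fdet_three_term_drop_first[where a = a and b = "\<lambda>_. 0" and \<beta> = "\<lambda>_. 1" and v = "\<lambda>_. 0"
      and u = "\<lambda>_. 1" and l = 1 and \<kappa> = \<kappa>], goal_cases)
    case (1 k i)
    then show ?case by (simp add: r)
  next
    case (4 i)
    then show ?case using r[of N i] by simp
  qed (use \<kappa> in simp_all)
  then show ?thesis by (simp add: algebra_simps)
qed

lemma fdet_chain_three_term_twisted:
  fixes r s :: "nat \<Rightarrow> nat \<Rightarrow> complex"
  assumes r: "\<And>k i. k \<le> N \<Longrightarrow> i \<le> N \<Longrightarrow> r k i = a k * r (Suc k) i + d k * (\<kappa> i * s k i)"
    and \<kappa>: "a N = 1 \<or> (\<forall>i<N. \<kappa> i \<noteq> 0)"
    and \<theta>: "\<And>i. i < N \<Longrightarrow> \<theta> i * \<kappa> (Suc i) = \<kappa> i * \<eta> i"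
  shows "d N * fdet (Suc N) r * fdet N (\<lambda>k i. s (Suc k) i + \<eta> i * s (Suc k) (Suc i)) =
    d 0 * d N * \<kappa> N * fdet (Suc N) s * fdet N (\<lambda>k i. r (Suc k) i + \<theta> i * r (Suc k) (Suc i))
    + d 0 * a N * fdet N (\<lambda>k i. s k i + \<eta> i * s k (Suc i)) * fdet (Suc N) (\<lambda>k. r (Suc k))"
proof -
  have "(\<Prod>k<N. 1) * (- d N) * (1 * fdet (Suc N) r * fdet N (\<lambda>k i. s (Suc k) i + \<eta> i * s (Suc k) (Suc i))
      - d 0 * \<kappa> N * fdet (Suc N) s * fdet N (\<lambda>k i. r (Suc k) i + \<theta> i * r (Suc k) (Suc i)))
    + d 0 * (\<Prod>k<N. 1) * a N * fdet N (\<lambda>k i. s k i + \<eta> i * s k (Suc i)) * fdet (Suc N) (\<lambda>k. r (Suc k)) = 0"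
  proof (rule fdet_three_term_twisted[where a = a and b = "\<lambda>_. 0" and \<beta> = "\<lambda>_. 1" and v = "\<lambda>_. 0"
      and u = "\<lambda>_. 1" and l = 1 and \<kappa> = \<kappa> and \<theta> = \<theta> and \<eta> = \<eta>], goal_cases)
    case (1 k i)
    then show ?case by (simp add: r)
  next
    case (4 i)
    then show ?case using r[of N i] by simp
  qed (use \<kappa> \<theta> in simp_all)
  then show ?thesis by (simp add: algebra_simps)
qed

subsection \<open>Contiguity relations\<close>

locale contiguity =
  fixes q :: complex and psi :: "complex \<Rightarrow> complex \<Rightarrow> complex \<Rightarrow> complex"
  assumes q: "q \<noteq> 0"
    and R1: "psi (q * t) x y = x * psi t x y + (1 - x) * psi (q * t) (x / q) y"
    and R2: "y * psi (q * t) x y = psi t x y + (y - 1) * psi t x (q * y)"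
    and R3: "q * t * x * y * psi (q * t) x y = (q * t * x - 1) * psi t x y + psi t (q * x) y"
    and R4: "q * t * psi (q * t) x y = (q * t * x - 1) * psi t x y + psi (q * t) x (y / q)"
begin

lemma R3': "psi t x y = t * x * y * psi (q * t) (x / q) y + (1 - t * x) * psi t (x / q) y"
  using R3[of t "x / q" y] q by (simp add: algebra_simps)

lemma R4': "psi (q * t) x y = q * t * psi (q * t) x (q * y) + (1 - q * t * x) * psi t x (q * y)"
  using R4[of t x "q * y"] q by (simp add: algebra_simps)

text \<open>In this and the further eliminated relations at most one coefficient involves both
  \<open>x\<close> and \<open>y\<close>, and it is a product of a factor in \<open>x\<close> and a
  factor in \<open>y\<close>. In a chain these become the coefficient \<open>d\<close> and the
  coordinate factor \<open>\<kappa>\<close>.\<close>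

lemma R8: "psi (q * t) x y = psi t x (q * y) + q * t * (1 - x) * psi (q * t) (x / q) (q * y)"
proof -
  have "A = D + q * t * (1 - x) * E"
    if "A = q * t * B + (1 - q * t * x) * D" "B = x * D + (1 - x) * E" for A B D E
    using that by Groebner_Basis.algebra
  from this[OF R4' R1] show ?thesis .
qed

lemma R7: "psi t x y = psi t x (q * y) + q * t * y * (1 - x) * psi (q * t) (x / q) (q * y)"
proof -
  have "B = D + q * t * y * (1 - x) * E"
    if "A = D + q * t * (1 - x) * E" "y * A = B + (y - 1) * D" for A B D E
    using that by Groebner_Basis.algebra
  from this[OF R8 R2] show ?thesis .
qed

lemma R10: "x * psi t x y = psi t x (q * y) + (1 - x) * (t * x - 1) * psi t (x / q) (q * y)"
proof -
  have "x * A = B + (1 - x) * (t * x - 1) * E"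
    if "A = B + q * t * y * (1 - x) * D" "B = t * x * (q * y) * D + (1 - t * x) * E" for A B D E
    using that by Groebner_Basis.algebra
  from this[OF R7 R3'] show ?thesis .
qed

lemma R4'': "psi (q * t) (x / q) y
    = q * t * psi (q * t) (x / q) (q * y) + (1 - t * x) * psi t (x / q) (q * y)"
  using R4'[of t "x / q" y] q by simp

lemma R9: "psi t x y = psi t (x / q) y - t * x * (1 - y) * psi t (x / q) (q * y)"
proof -
  have "A = B - t * x * (1 - y) * D"
    if "A = t * x * y * E + (1 - t * x) * B" "y * E = B + (y - 1) * D" for A B D E
    using that by Groebner_Basis.algebra
  from this[OF R3' R2] show ?thesis .
qed

lemma R12: "psi t x y = psi (q * t) (x / q) y + q * t * (y - 1) * psi (q * t) (x / q) (q * y)"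
proof -
  have "A = B + q * t * (y - 1) * D"
    if "B = q * t * D + (1 - t * x) * E" "A = F + q * t * y * (1 - x) * D"
      "F = t * x * (q * y) * D + (1 - t * x) * E" for A B D E F
    using that by Groebner_Basis.algebra
  from this[OF R4'' R7 R3'] show ?thesis .
qed

section \<open>Casorati determinants on the lattice of shifted parameters\<close>

definition X :: "complex \<Rightarrow> nat \<Rightarrow> complex" where "X x a = x / q ^ a"
definition Y :: "complex \<Rightarrow> nat \<Rightarrow> complex" where "Y y b = q ^ b * y"

lemma X_0 [simp]: "X x 0 = x" and Y_0 [simp]: "Y y 0 = y"
  by (simp_all add: X_def Y_def)

lemma X_Suc: "X x (Suc a) = X x a / q" and Y_Suc: "Y y (Suc b) = q * Y y b"
  by (simp_all add: X_def Y_def)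

lemma X_div: "X (x / q) a = X x (Suc a)" and Y_mult: "Y (q * y) b = Y y (Suc b)"
  by (simp_all add: X_def Y_def mult.commute)

lemma q_power_X: "q ^ a * X x a = x"
  using q by (simp add: X_def)

lemma X_nonzero: "x \<noteq> 0 \<Longrightarrow> X x a \<noteq> 0" and Y_nonzero: "y \<noteq> 0 \<Longrightarrow> Y y b \<noteq> 0"
  using q by (simp_all add: X_def Y_def)

definition lat :: "complex \<Rightarrow> complex \<Rightarrow> complex \<Rightarrow> nat \<Rightarrow> nat \<Rightarrow> complex" where
  "lat t x y a b = psi t (X x a) (Y y b)"

lemma lat_x: "lat t (x / q) y = (\<lambda>a. lat t x y (Suc a))"
  by (simp add: lat_def X_div fun_eq_iff)

lemma lat_y: "lat t x (q * y) = (\<lambda>a b. lat t x y a (Suc b))"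
  by (simp add: lat_def Y_mult fun_eq_iff)

lemma lat_R1:
  "lat (q * t) x y a b = X x a * lat t x y a b + (1 - X x a) * lat (q * t) x y (Suc a) b"
  unfolding lat_def X_Suc Y_Suc by (rule R1)

lemma lat_R2:
  "Y y b * lat (q * t) x y a b = lat t x y a b + (Y y b - 1) * lat t x y a (Suc b)"
  unfolding lat_def X_Suc Y_Suc by (rule R2)

lemma lat_R3:
  "lat t x y a b = t * X x a * Y y b * lat (q * t) x y (Suc a) b
    + (1 - t * X x a) * lat t x y (Suc a) b"
  unfolding lat_def X_Suc Y_Suc by (rule R3')

lemma lat_R7:
  "lat t x y a b = lat t x y a (Suc b)
    + q * t * Y y b * (1 - X x a) * lat (q * t) x y (Suc a) (Suc b)"
  unfolding lat_def X_Suc Y_Suc by (rule R7)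

lemma lat_R8:
  "lat (q * t) x y a b = lat t x y a (Suc b)
    + q * t * (1 - X x a) * lat (q * t) x y (Suc a) (Suc b)"
  unfolding lat_def X_Suc Y_Suc by (rule R8)

lemma lat_R9:
  "lat t x y a b = lat t x y (Suc a) b
    - t * X x a * (1 - Y y b) * lat t x y (Suc a) (Suc b)"
  unfolding lat_def X_Suc Y_Suc by (rule R9)

lemma lat_R10:
  "X x a * lat t x y a b = lat t x y a (Suc b)
    + (1 - X x a) * (t * X x a - 1) * lat t x y (Suc a) (Suc b)"
  unfolding lat_def X_Suc Y_Suc by (rule R10)

lemma lat_R12:
  "lat t x y a b = lat (q * t) x y (Suc a) b
    + q * t * (Y y b - 1) * lat (q * t) x y (Suc a) (Suc b)"
  unfolding lat_def X_Suc Y_Suc by (rule R12)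

text \<open>The determinant \<open>T\<^sub>N\<close> from the beginning, transposed: the first index
  counts shifts of \<open>x\<close>.\<close>

definition cas :: "nat \<Rightarrow> complex \<Rightarrow> complex \<Rightarrow> complex \<Rightarrow> complex" where
  "cas N t x y = fdet N (lat t x y)"

lemma cas_eq_rows: "cas N t x y = fdet N (\<lambda>i j. lat t x y j i)"
  unfolding cas_def by (rule fdet_transpose[symmetric])

lemma cas_0 [simp]: "cas 0 t x y = 1"
  by (simp add: cas_def)

text \<open>The chain index is the shift of \<open>x\<close> in the first form and the shift of
  \<open>y\<close> in the second; shifted parameters turn into shifted indices.\<close>

lemmas cas_by_cols = cas_def lat_x lat_y
lemmas cas_by_rows = cas_eq_rows lat_x lat_y

subsection \<open>Bilinear identities\<close>

text \<open>The chain runs in \<open>x\<close>, with the values at \<open>q * t\<close> as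
  \<open>r\<close> and those at \<open>t\<close> as \<open>s\<close>. Gives the numerator of
  \<open>f + 1/s\<close> for \<open>N \<ge> 0\<close>.\<close>

lemma cas_bilinear_R1:
  assumes x: "x \<noteq> 0"
  shows "cas (Suc N) (q * t) x y * cas N t (x / q) y =
    x * cas (Suc N) t x y * cas N (q * t) (x / q) y
    + q ^ N * (1 - X x N) * cas N t x y * cas (Suc N) (q * t) (x / q) y"
proof -
  \<comment> \<open>The power becomes an atom, so that the Groebner procedure treats it as an
    indeterminate.\<close>
  obtain Q where Q: "q ^ N = Q" by simp
  have "X x N * cas (Suc N) (q * t) x y * cas N t (x / q) y =
    X x 0 * X x N * 1 * cas (Suc N) t x y * cas N (q * t) (x / q) y
    + X x 0 * (1 - X x N) * cas N t x y * cas (Suc N) (q * t) (x / q) y"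
    unfolding cas_by_cols
  proof (rule fdet_chain_three_term[where d = "X x" and a = "\<lambda>k. 1 - X x k" and \<kappa> = "\<lambda>_. 1"], goal_cases)
    case (1 k i)
    show ?case using lat_R1[of t x y k i] by Groebner_Basis.algebra
  qed (use q in simp_all)
  \<comment> \<open>Since \<open>x = q ^ N * X x N\<close>, the nonzero factor \<open>X x N\<close>
    splits off.\<close>
  then have "X x N * (cas (Suc N) (q * t) x y * cas N t (x / q) y
    - (x * cas (Suc N) t x y * cas N (q * t) (x / q) y
    + q ^ N * (1 - X x N) * cas N t x y * cas (Suc N) (q * t) (x / q) y)) = 0"
    using q_power_X[of N x] unfolding X_0 Y_0 Q by Groebner_Basis.algebra
  then show ?thesis using X_nonzero[OF x, of N] by simp
qed

text \<open>At \<open>q * t\<close> the relation joins diagonally adjacent lattice points, so it is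
  no chain. It serves as the closing equation between chains from \<open>lat_R10\<close> for
  \<open>w\<close> and from \<open>lat_R1\<close> for \<open>s\<close> and \<open>p\<close>. Gives
  \<open>f + B3\<close> for \<open>N \<ge> 0\<close>.\<close>

lemma cas_bilinear_R8:
  assumes x: "x \<noteq> 0"
  shows "cas (Suc N) (q * t) x y * cas N t (x / q) (q * (q * y)) =
    cas (Suc N) t x (q * y) * cas N (q * t) (x / q) (q * y)
    + q * q ^ N * t * (1 - X x N) * cas N t x (q * y) * cas (Suc N) (q * t) (x / q) (q * y)"
proof -
  obtain Q where Q: "q ^ N = Q" by simp
  define U where "U = (\<Prod>k<N. X x (Suc k))"
  have "U * 1 * (X x 0 * cas (Suc N) t x (q * y) * cas N (q * t) (x / q) (q * y)
      - X x 0 * 1 * cas (Suc N) (q * t) x y * cas N t (x / q) (q * (q * y)))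
    + X x 0 * (\<Prod>k<N. X x k) * (q * t * (1 - X x N)) * cas N t x (q * y) * cas (Suc N) (q * t) (x / q) (q * y) = 0"
    unfolding cas_by_cols U_def
  proof (rule fdet_three_term_drop_first[where \<alpha> = "X x" and \<kappa> = "\<lambda>i. 1" and \<beta> = "X x"
      and u = "\<lambda>k. X x (Suc k)" and a = "\<lambda>k. (1 - X x k) * (1 - t * X x k)"
      and b = "\<lambda>k. 1 - X x k" and v = "\<lambda>k. 1 - X x (Suc k)" and l = "- 1"], goal_cases)
    case (1 k i)
    show ?case using lat_R10[of x k t y i] by Groebner_Basis.algebra
  next
    case (2 k i)
    show ?case using lat_R1[of t x y k i] by simp
  next
    case (3 k i)
    show ?case using lat_R1[of t x y "Suc k" "Suc i"] by simp
  next
    case (4 i)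
    show ?case using lat_R8[of t x y N i] by simp
  qed simp_all
  moreover have "(\<Prod>k<N. X x k) = q ^ N * U"
    unfolding U_def using q by (induction N) (simp_all add: X_Suc)
  ultimately have "(x * U) * (cas (Suc N) (q * t) x y * cas N t (x / q) (q * (q * y))
    - (cas (Suc N) t x (q * y) * cas N (q * t) (x / q) (q * y)
    + q * q ^ N * t * (1 - X x N) * cas N t x (q * y) * cas (Suc N) (q * t) (x / q) (q * y))) = 0"
    unfolding X_0 Q by Groebner_Basis.algebra
  moreover have "U \<noteq> 0"
    unfolding U_def using X_nonzero[OF x] by simp
  ultimately show ?thesis using x by simp
qed

text \<open>The chain runs in \<open>y\<close>. Its coordinate factor
  \<open>q * t * (1 - X x j)\<close> may vanish, which is harmless as \<open>a = 1\<close>. Gives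
  \<open>f + 1\<close> for \<open>N \<ge> 0\<close>.\<close>

lemma cas_bilinear_R7:
  assumes y: "y \<noteq> 0"
  shows "q ^ N * cas (Suc N) t x y * cas N (q * t) (x / q) (q * (q * y)) =
    q * q ^ N * t * y * (1 - X x N) * cas N t x (q * y) * cas (Suc N) (q * t) (x / q) (q * y)
    + cas N (q * t) (x / q) (q * y) * cas (Suc N) t x (q * y)"
proof -
  obtain Q where Q: "q ^ N = Q" by simp
  have "Y y N * cas (Suc N) t x y * cas N (q * t) (x / q) (q * (q * y)) =
    Y y 0 * Y y N * (q * t * (1 - X x N)) * cas (Suc N) (q * t) (x / q) (q * y) * cas N t x (q * y)
    + Y y 0 * 1 * cas N (q * t) (x / q) (q * y) * cas (Suc N) t x (q * y)"
    unfolding cas_by_rows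
  proof (rule fdet_chain_three_term[where d = "Y y" and a = "\<lambda>k. 1" and \<kappa> = "\<lambda>j. q * t * (1 - X x j)"], goal_cases)
    case (1 k i)
    show ?case using lat_R7[of t x y i k] by Groebner_Basis.algebra
  qed (use q in simp_all)
  then have "y * (q ^ N * cas (Suc N) t x y * cas N (q * t) (x / q) (q * (q * y))
    - (q * q ^ N * t * y * (1 - X x N) * cas N t x (q * y) * cas (Suc N) (q * t) (x / q) (q * y)
    + cas N (q * t) (x / q) (q * y) * cas (Suc N) t x (q * y))) = 0"
    unfolding Y_def power_0 Q by Groebner_Basis.algebra
  then show ?thesis using y by simp
qed

text \<open>The chain runs in \<open>x\<close> at fixed \<open>t\<close>. Taken at
  \<open>q * t\<close>, it gives \<open>g(qt) + 1/(B1 B2)\<close> for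
  \<open>N \<ge> 0\<close>.\<close>

lemma cas_bilinear_R10:
  assumes x: "x \<noteq> 0"
  shows "cas (Suc N) t x (q * y) * cas N t (x / q) (q * y) =
    x * cas (Suc N) t x y * cas N t (x / q) (q * (q * y))
    + q ^ N * (1 - X x N) * (1 - t * X x N) * cas N t x (q * y) * cas (Suc N) t (x / q) (q * y)"
proof -
  obtain Q where Q: "q ^ N = Q" by simp
  have "X x N * cas (Suc N) t x (q * y) * cas N t (x / q) (q * y) =
    X x 0 * X x N * 1 * cas (Suc N) t x y * cas N t (x / q) (q * (q * y))
    + X x 0 * ((1 - X x N) * (1 - t * X x N)) * cas N t x (q * y) * cas (Suc N) t (x / q) (q * y)"
    unfolding cas_by_cols
  proof (rule fdet_chain_three_term_drop_first[where d = "X x" and a = "\<lambda>k. (1 - X x k) * (1 - t * X x k)" and \<kappa> = "\<lambda>_. 1"], goal_cases)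
    case (1 k i)
    show ?case using lat_R10[of x k t y i] by Groebner_Basis.algebra
  qed (use q in simp_all)
  then have "X x N * (cas (Suc N) t x (q * y) * cas N t (x / q) (q * y)
    - (x * cas (Suc N) t x y * cas N t (x / q) (q * (q * y))
    + q ^ N * (1 - X x N) * (1 - t * X x N) * cas N t x (q * y) * cas (Suc N) t (x / q) (q * y))) = 0"
    using q_power_X[of N x] unfolding X_0 Y_0 Q by Groebner_Basis.algebra
  then show ?thesis using X_nonzero[OF x, of N] by simp
qed

text \<open>The chain runs in \<open>x\<close>; its coordinate factor \<open>Y y\<close> has no
  zeros, as the drop-first form requires. Gives \<open>f + 1/s\<close> for
  \<open>N < 0\<close>.\<close>

lemma cas_bilinear_R3:
  assumes x: "x \<noteq> 0" and y: "y \<noteq> 0" and t: "t \<noteq> 0"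
  shows "cas (Suc N) t x y * cas N (q * t) (x / q / q) (q * y) =
    t * x * y * cas (Suc N) (q * t) (x / q) y * cas N t (x / q) (q * y)
    + q ^ N * (1 - t * X x N) * cas N (q * t) (x / q) (q * y) * cas (Suc N) t (x / q) y"
proof -
  obtain Q where Q: "q ^ N = Q" by simp
  have "t * X x N * cas (Suc N) t x y * cas N (q * t) (x / q / q) (q * y) =
    t * X x 0 * (t * X x N) * Y y 0 * cas (Suc N) (q * t) (x / q) y * cas N t (x / q) (q * y)
    + t * X x 0 * (1 - t * X x N) * cas N (q * t) (x / q) (q * y) * cas (Suc N) t (x / q) y"
    unfolding cas_by_cols
  proof (rule fdet_chain_three_term_drop_first[where d = "\<lambda>k. t * X x k" and a = "\<lambda>k. 1 - t * X x k" and \<kappa> = "Y y"], goal_cases)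
    case (1 k i)
    show ?case using lat_R3[of t x y k i] by Groebner_Basis.algebra
  qed (use Y_nonzero[OF y] in simp_all)
  then have "(t * X x N) * (cas (Suc N) t x y * cas N (q * t) (x / q / q) (q * y)
    - (t * x * y * cas (Suc N) (q * t) (x / q) y * cas N t (x / q) (q * y)
    + q ^ N * (1 - t * X x N) * cas N (q * t) (x / q) (q * y) * cas (Suc N) t (x / q) y)) = 0"
    using q_power_X[of N x] unfolding X_0 Y_0 Q by Groebner_Basis.algebra
  then show ?thesis using t X_nonzero[OF x, of N] by simp
qed

text \<open>The chain runs in \<open>y\<close>, with the values at \<open>q * t\<close> and
  \<open>x / q\<close> as \<open>r\<close>. Gives \<open>f + 1\<close> for
  \<open>N < 0\<close>.\<close>

lemma cas_bilinear_R12: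
  "cas (Suc N) t x y * cas N (q * t) (x / q / q) (q * y) =
    cas (Suc N) (q * t) (x / q) y * cas N t (x / q) (q * y)
    - q * t * (1 - Y y N) * cas N t (x / q) y * cas (Suc N) (q * t) (x / q) (q * y)"
proof -
  obtain Q where Q: "q ^ N = Q" by simp
  have "1 * cas (Suc N) (q * t) (x / q) y * cas N t (x / q) (q * y) =
    1 * 1 * 1 * cas (Suc N) t x y * cas N (q * t) (x / q / q) (q * y)
    + 1 * (q * t * (1 - Y y N)) * cas N t (x / q) y * cas (Suc N) (q * t) (x / q) (q * y)"
    unfolding cas_by_rows
  proof (rule fdet_chain_three_term_drop_first[where d = "\<lambda>k. 1" and a = "\<lambda>k. q * t * (1 - Y y k)" and \<kappa> = "\<lambda>i. 1"], goal_cases)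
    case (1 k i)
    show ?case using lat_R12[of t x y i k] by Groebner_Basis.algebra
  qed (use q in simp_all)
  then have "1 * (cas (Suc N) t x y * cas N (q * t) (x / q / q) (q * y)
    - (cas (Suc N) (q * t) (x / q) y * cas N t (x / q) (q * y)
    - q * t * (1 - Y y N) * cas N t (x / q) y * cas (Suc N) (q * t) (x / q) (q * y))) = 0"
    unfolding Y_def power_0 Q by Groebner_Basis.algebra
  then show ?thesis using q by simp
qed

text \<open>The chain runs in \<open>y\<close>. An auxiliary identity for the elimination in
  \<open>cas_bilinear_R13\<close>.\<close>

lemma cas_bilinear_R2:
  assumes y: "y \<noteq> 0"
  shows "q ^ N * cas (Suc N) t x y * cas N (q * t) x (q * y) =
    Y y N * cas (Suc N) (q * t) x y * cas N t x (q * y)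
    + (1 - Y y N) * cas N (q * t) x y * cas (Suc N) t x (q * y)"
proof -
  obtain Q where Q: "q ^ N = Q" by simp
  have "Y y N * cas (Suc N) t x y * cas N (q * t) x (q * y) =
    Y y 0 * Y y N * 1 * cas (Suc N) (q * t) x y * cas N t x (q * y)
    + Y y 0 * (1 - Y y N) * cas N (q * t) x y * cas (Suc N) t x (q * y)"
    unfolding cas_by_rows
  proof (rule fdet_chain_three_term[where d = "Y y" and a = "\<lambda>k. 1 - Y y k" and \<kappa> = "\<lambda>_. 1"], goal_cases)
    case (1 k i)
    show ?case using lat_R2[of y k t x i] by Groebner_Basis.algebra
  qed (use q in simp_all)
  then have "y * (q ^ N * cas (Suc N) t x y * cas N (q * t) x (q * y)
    - (Y y N * cas (Suc N) (q * t) x y * cas N t x (q * y)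
    + (1 - Y y N) * cas N (q * t) x y * cas (Suc N) t x (q * y))) = 0"
    unfolding Y_def power_0 Q by Groebner_Basis.algebra
  then show ?thesis using y by simp
qed

text \<open>The chain runs in \<open>x\<close>; the coordinate factor \<open>1 - Y y i\<close> may
  vanish, but \<open>a = 1\<close>. Taken at \<open>q * t\<close>, it gives
  \<open>g(qt) + 1/(B1 B2)\<close> for \<open>N < 0\<close>.\<close>

lemma cas_bilinear_R9:
  assumes x: "x \<noteq> 0" and t: "t \<noteq> 0"
  shows "cas (Suc N) t x y * cas N t (x / q / q) (q * y) =
    q ^ N * cas N t (x / q) (q * y) * cas (Suc N) t (x / q) y
    - t * x * (1 - Y y N) * cas (Suc N) t (x / q) (q * y) * cas N t (x / q) y"
proof -
  obtain Q where Q: "q ^ N = Q" by simp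
  have "- t * X x N * cas (Suc N) t x y * cas N t (x / q / q) (q * y) =
    - t * X x 0 * (- t * X x N) * (1 - Y y N) * cas (Suc N) t (x / q) (q * y) * cas N t (x / q) y
    + - t * X x 0 * 1 * cas N t (x / q) (q * y) * cas (Suc N) t (x / q) y"
    unfolding cas_by_cols
  proof (rule fdet_chain_three_term[where d = "\<lambda>k. - t * X x k" and a = "\<lambda>k. 1" and \<kappa> = "\<lambda>i. 1 - Y y i"], goal_cases)
    case (1 k i)
    show ?case using lat_R9[of t x y k i] by Groebner_Basis.algebra
  qed (use q in simp_all)
  then have "(t * X x N) * (cas (Suc N) t x y * cas N t (x / q / q) (q * y)
    - (q ^ N * cas N t (x / q) (q * y) * cas (Suc N) t (x / q) y
    - t * x * (1 - Y y N) * cas (Suc N) t (x / q) (q * y) * cas N t (x / q) y)) = 0"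
    using q_power_X[of N x] unfolding X_0 Y_0 Q by Groebner_Basis.algebra
  then show ?thesis using t X_nonzero[OF x, of N] by simp
qed

text \<open>By \<open>lat_R2\<close>, a bidiagonal change of the \<open>y\<close> coordinates moves
  \<open>t\<close> to \<open>q * t\<close>, up to one scalar per coordinate.
  \<open>cas_col_change\<close> is its counterpart in \<open>x\<close> by \<open>lat_R1\<close> and
  moves \<open>q * t\<close> back to \<open>t\<close>. These are the twists used below.\<close>

lemma cas_row_change:
  "(\<Prod>i<N. Y y i) * cas N (q * t) x y =
    fdet N (\<lambda>k i. lat t x y k i + (Y y i - 1) * lat t x y k (Suc i))"
  unfolding cas_def fdet_scale_cols[symmetric] lat_R2 ..

lemma cas_col_change:
  "(\<Prod>j<N. X x j) * cas N t x y =
    fdet N (\<lambda>i j. lat (q * t) x y j i + (X x j - 1) * lat (q * t) x y (Suc j) i)"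
  unfolding cas_eq_rows fdet_scale_cols[symmetric]
proof (rule fdet_cong)
  show "X x j * lat t x y j i = lat (q * t) x y j i + (X x j - 1) * lat (q * t) x y (Suc j) i" for i j
    using lat_R1[of t x y j i] by Groebner_Basis.algebra
qed

lemma prod_X_Suc: "(\<Prod>k<N. X x k) = q ^ N * (\<Prod>k<N. X x (Suc k))"
  using q by (induction N) (simp_all add: X_Suc)

lemma prod_Y_Suc: "(\<Prod>k<N. Y y (Suc k)) = q ^ N * (\<Prod>k<N. Y y k)"
  by (induction N) (simp_all add: Y_Suc)

text \<open>The chain of \<open>cas_bilinear_R1\<close>, with \<open>t\<close> in the smaller
  determinants advanced by the twist in \<open>y\<close>.\<close>

lemma cas_bilinear_R1_twisted:
  assumes x: "x \<noteq> 0" and y: "y \<noteq> 0"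
  shows "cas (Suc N) (q * t) x y * cas N (q * t) (x / q) y =
    x * cas (Suc N) t x y * cas N (q * (q * t)) (x / q) y
    + q ^ N * (1 - X x N) * cas N (q * t) x y * cas (Suc N) (q * t) (x / q) y"
proof -
  obtain Q where Q: "q ^ N = Q" by simp
  define P where "P = (\<Prod>i<N. Y y i)"
  have P: "P \<noteq> 0" using Y_nonzero[OF y] by (simp add: P_def)
  have "X x N * cas (Suc N) (q * t) x y * (P * cas N (q * t) (x / q) y) =
    X x 0 * X x N * 1 * cas (Suc N) t x y * (P * cas N (q * (q * t)) (x / q) y)
    + X x 0 * (1 - X x N) * (P * cas N (q * t) x y) * cas (Suc N) (q * t) (x / q) y"
    unfolding P_def cas_row_change unfolding cas_by_cols
  proof (rule fdet_chain_three_term_twisted[where d = "X x" and a = "\<lambda>k. 1 - X x k" and \<kappa> = "\<lambda>_. 1"], goal_cases)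
    case (1 k i)
    show ?case using lat_R1[of t x y k i] by Groebner_Basis.algebra
  qed simp_all
  then have "P * X x N * (cas (Suc N) (q * t) x y * cas N (q * t) (x / q) y
    - (x * cas (Suc N) t x y * cas N (q * (q * t)) (x / q) y
    + q ^ N * (1 - X x N) * cas N (q * t) x y * cas (Suc N) (q * t) (x / q) y)) = 0"
    using q_power_X[of N x] unfolding X_0 Q by Groebner_Basis.algebra
  then show ?thesis using P X_nonzero[OF x, of N] by simp
qed

text \<open>The product \<open>cas N (q * t) x (q * y) * cas (Suc N) (q * t) (x / q) (q * y)\<close>
  occurs both in \<open>cas_bilinear_R10\<close> at \<open>q * t\<close> and in the twisted R1
  identity at \<open>q * y\<close>; eliminating it leaves the claim. Gives
  \<open>g(qt) + qt/B2\<close> for \<open>N \<ge> 0\<close>.\<close>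

lemma cas_bilinear_R4:
  assumes x: "x \<noteq> 0" and y: "y \<noteq> 0"
  shows "q ^ N * cas (Suc N) (q * t) x y * cas N (q * t) (x / q) (q * (q * y)) =
    q * t * cas (Suc N) (q * t) x (q * y) * cas N (q * t) (x / q) (q * y)
    + (1 - q * t * X x N) * q ^ N * cas (Suc N) t x (q * y) * cas N (q * (q * t)) (x / q) (q * y)"
proof -
  obtain Q where Q: "q ^ N = Q" by simp
  have "X x N * (q ^ N * cas (Suc N) (q * t) x y * cas N (q * t) (x / q) (q * (q * y)) -
    (q * t * cas (Suc N) (q * t) x (q * y) * cas N (q * t) (x / q) (q * y)
    + (1 - q * t * X x N) * q ^ N * cas (Suc N) t x (q * y) * cas N (q * (q * t)) (x / q) (q * y))) = 0"
    using cas_bilinear_R10[OF x, of N "q * t" y] cas_bilinear_R1_twisted[OF x, of "q * y" N t] q y q_power_X[of N x]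
    unfolding Q by simp Groebner_Basis.algebra
  then show ?thesis using X_nonzero[OF x, of N] by simp
qed

text \<open>The chain of \<open>cas_bilinear_R7\<close> at \<open>q * t\<close>, with the smaller
  determinants moved back in \<open>t\<close> by the twist in \<open>x\<close>. The twists
  \<open>X x j - 1\<close> and \<open>X x (Suc j) - 1\<close> are compatible because
  \<open>\<kappa>\<close> is proportional to \<open>1 - X x j\<close>. Gives
  \<open>g(qt) + 1/B2\<close> for \<open>N \<ge> 0\<close>.\<close>

lemma cas_bilinear_R7_twisted:
  assumes x: "x \<noteq> 0" and y: "y \<noteq> 0"
  shows "q ^ N * cas (Suc N) (q * t) x y * cas N (q * t) (x / q) (q * (q * y)) =
    q ^ N * q ^ N * q * (q * t) * y * (1 - X x N) * cas (Suc N) (q * (q * t)) (x / q) (q * y) * cas N t x (q * y)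
    + cas N (q * t) (x / q) (q * y) * cas (Suc N) (q * t) x (q * y)"
proof -
  obtain Q where Q: "q ^ N = Q" by simp
  define P where "P = (\<Prod>j<N. X x (Suc j))"
  have P: "P \<noteq> 0" using X_nonzero[OF x] by (simp add: P_def)
  have tw1: "P * cas N (q * t) (x / q) y =
      fdet N (\<lambda>i j. lat (q * (q * t)) (x / q) y j i + (X x (Suc j) - 1) * lat (q * (q * t)) (x / q) y (Suc j) i)" for y
    using cas_col_change[where x = "x / q" and N = N and t = "q * t" and y = y] by (simp add: X_div P_def)
  have tw2: "q ^ N * P * cas N t x y =
      fdet N (\<lambda>i j. lat (q * t) x y j i + (X x j - 1) * lat (q * t) x y (Suc j) i)" for y
    unfolding P_def prod_X_Suc[symmetric] by (rule cas_col_change)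
  have "Y y N * cas (Suc N) (q * t) x y * (P * cas N (q * t) (x / q) (q * (q * y))) =
    Y y 0 * Y y N * (q * (q * t) * (1 - X x N)) * cas (Suc N) (q * (q * t)) (x / q) (q * y) * (q ^ N * P * cas N t x (q * y))
    + Y y 0 * 1 * (P * cas N (q * t) (x / q) (q * y)) * cas (Suc N) (q * t) x (q * y)"
    unfolding tw1 tw2 unfolding cas_by_rows
  proof (rule fdet_chain_three_term_twisted[where d = "Y y" and a = "\<lambda>k. 1"
        and \<kappa> = "\<lambda>j. q * (q * t) * (1 - X x j)"], goal_cases)
    case (1 k i)
    show ?case using lat_R7[of "q * t" x y i k] by Groebner_Basis.algebra
  next
    case (3 j)
    show ?case by Groebner_Basis.algebra
  qed simp_all
  then have "P * y * (q ^ N * cas (Suc N) (q * t) x y * cas N (q * t) (x / q) (q * (q * y)) -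
    (q ^ N * q ^ N * q * (q * t) * y * (1 - X x N) * cas (Suc N) (q * (q * t)) (x / q) (q * y) * cas N t x (q * y)
    + cas N (q * t) (x / q) (q * y) * cas (Suc N) (q * t) x (q * y))) = 0"
    unfolding Y_def power_0 Q by Groebner_Basis.algebra
  then show ?thesis using P y by simp
qed

text \<open>The chain of \<open>cas_bilinear_R2\<close> at \<open>q * t\<close>, with the smaller
  determinants moved back by the twist in \<open>x\<close>. Gives \<open>g(qt) + qt/B2\<close> for
  \<open>N < 0\<close>.\<close>

lemma cas_bilinear_R2_twisted:
  assumes x: "x \<noteq> 0" and y: "y \<noteq> 0"
  shows "q ^ N * cas (Suc N) (q * t) x y * cas N (q * t) x (q * y) =
    Y y N * cas (Suc N) (q * (q * t)) x y * cas N t x (q * y)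
    + (1 - Y y N) * cas N (q * t) x y * cas (Suc N) (q * t) x (q * y)"
proof -
  obtain Q where Q: "q ^ N = Q" by simp
  define P where "P = (\<Prod>j<N. X x j)"
  have P: "P \<noteq> 0" using X_nonzero[OF x] by (simp add: P_def)
  have "Y y N * cas (Suc N) (q * t) x y * (P * cas N (q * t) x (q * y)) =
    Y y 0 * Y y N * 1 * cas (Suc N) (q * (q * t)) x y * (P * cas N t x (q * y))
    + Y y 0 * (1 - Y y N) * (P * cas N (q * t) x y) * cas (Suc N) (q * t) x (q * y)"
    unfolding P_def cas_col_change unfolding cas_by_rows
  proof (rule fdet_chain_three_term_twisted[where d = "Y y" and a = "\<lambda>k. 1 - Y y k" and \<kappa> = "\<lambda>_. 1"], goal_cases)
    case (1 k i)
    show ?case using lat_R2[of y k "q * t" x i] by Groebner_Basis.algebra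
  qed simp_all
  then have "P * y * (q ^ N * cas (Suc N) (q * t) x y * cas N (q * t) x (q * y) -
    (Y y N * cas (Suc N) (q * (q * t)) x y * cas N t x (q * y)
    + (1 - Y y N) * cas N (q * t) x y * cas (Suc N) (q * t) x (q * y))) = 0"
    unfolding Y_def power_0 Q by Groebner_Basis.algebra
  then show ?thesis using P y by simp
qed

text \<open>Here \<open>lat_R12\<close> is the closing equation; \<open>w\<close> is a chain by
  \<open>lat_R9\<close>, while \<open>s\<close> and \<open>p\<close> are chains by
  \<open>lat_R1\<close>. The twist in \<open>y\<close> advances \<open>t\<close> in the smaller
  determinants. Gives \<open>g(qt) + 1/B2\<close> for \<open>N < 0\<close>.\<close>

lemma cas_bilinear_R12_twisted:
  assumes x: "x \<noteq> 0" and y: "y \<noteq> 0" and t: "t \<noteq> 0"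
  shows "q ^ N * cas (Suc N) t x y * cas N (q * (q * t)) (x / q / q) (q * y)
    + q * t * (1 - Y y N) * cas (Suc N) (q * t) (x / q) (q * y) * cas N (q * t) (x / q) y =
    q ^ N * cas N (q * t) (x / q) (q * y) * cas (Suc N) (q * t) (x / q) y"
proof -
  obtain Q where Q: "q ^ N = Q" by simp
  define U where "U = (\<Prod>k<N. X x (Suc k))"
  define P where "P = (\<Prod>i<N. Y y i)"
  have PU: "P \<noteq> 0" "U \<noteq> 0" using X_nonzero[OF x] Y_nonzero[OF y] by (simp_all add: P_def U_def)
  have tw1: "P * cas N (q * t) x y = fdet N (\<lambda>k i. lat t x y k i + (Y y i - 1) * lat t x y k (Suc i))" for t x
    unfolding P_def by (rule cas_row_change)
  have tw2: "q ^ N * P * cas N (q * t) x (q * y) =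
      fdet N (\<lambda>k i. lat t x (q * y) k i + (Y y (Suc i) - 1) * lat t x (q * y) k (Suc i))" for t x
    using cas_row_change[where y = "q * y" and N = N and t = t and x = x] by (simp add: Y_mult P_def prod_Y_Suc)
  have "U * (q * t) * (X x (Suc 0) * cas (Suc N) t x y * (q ^ N * P * cas N (q * (q * t)) (x / q / q) (q * y))
      - - t * X x 0 * (1 - Y y N) * cas (Suc N) (q * t) (x / q) (q * y) * (P * cas N (q * t) (x / q) y))
    + - t * X x 0 * U * 1 * (q ^ N * P * cas N (q * t) (x / q) (q * y)) * cas (Suc N) (q * t) (x / q) y = 0"
    unfolding tw1 tw2 unfolding cas_by_cols U_def
  proof (rule fdet_three_term_twisted[where \<alpha> = "\<lambda>k. - t * X x k" and \<kappa> = "\<lambda>i. 1 - Y y i"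
      and \<beta> = "\<lambda>k. X x (Suc k)" and u = "\<lambda>k. X x (Suc k)" and a = "\<lambda>k. 1"
      and b = "\<lambda>k. 1 - X x (Suc k)" and v = "\<lambda>k. 1 - X x (Suc k)" and l = 1], goal_cases)
    case (1 k i)
    show ?case using lat_R9[of t x y k i] by Groebner_Basis.algebra
  next
    case (2 k i)
    show ?case using lat_R1[of t x y "Suc k" "Suc i"] by simp
  next
    case (3 k i)
    show ?case using lat_R1[of t x y "Suc k" i] by simp
  next
    case (4 i)
    show ?case using lat_R12[of t x y N i] by Groebner_Basis.algebra
  next
    case 5
    show ?case using q by (simp add: X_Suc)
  next
    case (7 i)
    show ?case by Groebner_Basis.algebra
  qed simp_all
  moreover have "q * X x (Suc 0) = x"
    using q by (simp add: X_Suc)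
  ultimately have "(x * t * P * U) * (q ^ N * cas (Suc N) t x y * cas N (q * (q * t)) (x / q / q) (q * y)
    + q * t * (1 - Y y N) * cas (Suc N) (q * t) (x / q) (q * y) * cas N (q * t) (x / q) y -
    q ^ N * cas N (q * t) (x / q) (q * y) * cas (Suc N) (q * t) (x / q) y) = 0"
    unfolding X_0 Q by Groebner_Basis.algebra
  then show ?thesis using x t PU by simp
qed

text \<open>
  The following identity belongs to \<open>\<psi>(t,x,y) - y \<psi>(qt,x/q,y) = (1 - tx) (1 - y) \<psi>(t,x/q,qy)\<close>, whose
  coefficients depend on both \<open>x\<close> and \<open>y\<close>, so it is not a chain relation; it is obtained by elimination.
\<close>

lemma cas_bilinear_R13:
  assumes x: "x \<noteq> 0" and y: "y \<noteq> 0" and t: "t \<noteq> 0"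
  shows "cas (Suc N) t x y * cas N (q * t) (x / q / q) (q * y) =
    Y y N * cas (Suc N) (q * t) (x / q) y * cas N t (x / q) (q * y)
    + (1 - t * X x N) * (1 - Y y N) * cas N (q * t) (x / q) y * cas (Suc N) t (x / q) (q * y)"
proof -
  obtain Q where Q: "q ^ N = Q" by simp
  show ?thesis
    \<comment> \<open>Both identities contain
      \<open>cas N (q * t) (x / q) (q * y) * cas (Suc N) t (x / q) y\<close>. After its elimination
      the first coefficient collapses to \<open>Y y N\<close>, since
      \<open>X x N * Y y N = x * y\<close>.\<close>
    using cas_bilinear_R3[OF x y t, of N] cas_bilinear_R2[OF y, of N t "x / q"] q_power_X[of N x]
    unfolding Y_def Q by Groebner_Basis.algebra
qed

section \<open>The tau functions as Casorati determinants\<close>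

lemma tau_nonneg: "tau q psi (int n) t x y = cas n t x y"
proof (cases n)
  case 0
  then show ?thesis by (simp add: tau_def)
next
  case (Suc m)
  have "q powi (- int j) * x = X x j" "q powi int j * y = Y y j" for j
    by (simp_all add: X_def Y_def power_int_minus field_simps)
  then show ?thesis
    unfolding cas_eq_rows fdet_def lat_def by (simp add: tau_def Suc nat_add_distrib)
qed

text \<open>Rows and columns are reversed by the same permutation, so the signs cancel. The
  parameters are \<open>x\<close> and \<open>y\<close> times the powers \<open>n - 1\<close> and
  \<open>1 - n\<close> of \<open>q\<close>, written without subtraction of naturals so that
  \<open>n = 0\<close> is included.\<close>

lemma tau_nonpos: "tau q psi (- int n) t x y = cas n t (q ^ n * x / q) (q * (y / q ^ n))"
proof (cases n)
  case 0
  then show ?thesis by (simp add: tau_def)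
next
  case (Suc m)
  define p where "p = (\<lambda>i. if i \<le> m then m - i else i)"
  have p: "p permutes {0..<n}"
    by (rule inj_imp_permutes) (auto simp: p_def Suc inj_on_def split: if_splits)
  let ?x = "q ^ n * x / q" and ?y = "q * (y / q ^ n)"
  have X: "X ?x (p j) = q powi int j * x" if "j < n" for j
    using that q by (simp add: X_def p_def Suc power_diff field_simps)
  have Y: "Y ?y (p j) = q powi (- int j) * y" if "j < n" for j
    using that q by (simp add: Y_def p_def Suc power_diff power_int_minus field_simps)
  have "cas n t ?x ?y = fdet n (\<lambda>i j. lat t ?x ?y (p j) (p i))"
  proof -
    have "fdet n (\<lambda>i j. lat t ?x ?y (p j) (p i)) = of_int (sign p) * (of_int (sign p) * cas n t ?x ?y)"
      unfolding cas_eq_rows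
      using fdet_permute_rows[OF p, of "\<lambda>i j. lat t ?x ?y (p j) i"]
        fdet_permute_cols[OF p, of "\<lambda>i j. lat t ?x ?y j i"] by simp
    then show ?thesis by (simp add: sign_def)
  qed
  also have "\<dots> = fdet n (\<lambda>i j. psi t (q powi int j * x) (q powi (- int i) * y))"
    by (intro fdet_cong) (simp only: lat_def X Y)
  also have "\<dots> = tau q psi (- int n) t x y"
    by (simp add: tau_def fdet_def Suc nat_add_distrib)
  finally show ?thesis ..
qed

end

subsection \<open>The solutions\<close>

text \<open>Here \<open>m / d\<close> is \<open>f t\<close> or \<open>g (q * t)\<close>, and
  \<open>u\<close>, \<open>v\<close>, \<open>w\<close> are the numerators of the three factors in a
  dP equation. Once the bilinear identities make these monomials, the equation is a polynomial
  identity; the nonvanishing denominator forces \<open>w\<close> to be nonzero.\<close>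

lemma quotient_identity:
  fixes m d :: "'a::field"
  assumes "d \<noteq> 0" "Ad \<noteq> 0" "Bd \<noteq> 0"
    and "m + a * d = u" "m + b * d = v" "m + c * d = w"
    and "m / d + c \<noteq> 0"
    and "An * Bn * w * d = K * u * v * Ad * Bd"
  shows "An / Ad * (Bn / Bd) = K * ((m / d + a) * (m / d + b)) / (m / d + c)"
proof -
  have eq: "m / d + a = u / d" "m / d + b = v / d" "m / d + c = w / d"
    using assms(1,4-6) by (auto simp: field_simps)
  have "w \<noteq> 0" using assms(7) unfolding eq by auto
  then show ?thesis
    unfolding eq using assms(1-3,8) by (simp add: field_simps)
qed

context contiguity
begin

lemma dP_solution_nonneg:
  assumes b1: "b1 \<noteq> 0" and b3: "b3 \<noteq> 0" and N: "N = int n"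
    and "fden q psi N b1 b3 t \<noteq> 0" "fden q psi N b1 b3 (q * t) \<noteq> 0"
    and "gden q psi N b1 b3 t \<noteq> 0" "gden q psi N b1 b3 (q * t) \<noteq> 0"
    and f: "fsol q psi N b1 b3 t + 1 / sfun q (q powi (- N) * b1) (q powi N) b3 t \<noteq> 0"
    and g: "gsol q psi N b1 b3 (q * t) + q * t / q powi N \<noteq> 0"
  shows "dP_eq1 q (q powi (- N) * b1) (q powi N) b3 (fsol q psi N b1 b3) (gsol q psi N b1 b3) t"
    and "dP_eq2 q (q powi (- N) * b1) (q powi N) b3 (fsol q psi N b1 b3) (gsol q psi N b1 b3) t"
proof -
  \<comment> \<open>\<open>Q\<close> and \<open>x\<close> are the parameter values \<open>B2\<close>
    and \<open>B1\<close>, so that \<open>Q * x = b1\<close>.\<close>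
  obtain Q where Q: "q ^ n = Q" by simp
  have Q0: "Q \<noteq> 0" using q by (simp flip: Q)
  obtain x where x: "X b1 n = x" by simp
  have pow: "q powi N = Q" "q powi (N + 1) = q * Q" "q powi (- N) * b1 = x"
    using q by (simp_all add: N power_int_minus power_int_add X_def field_simps flip: Q x)
  have Qx: "b1 = Q * x" using q_power_X[of n b1] by (simp add: Q x)
  have tau: "tau q psi N t x y = cas n t x y" "tau q psi (N + 1) t x y = cas (Suc n) t x y" for t x y
    using tau_nonneg[of n] tau_nonneg[of "Suc n"] by (simp_all add: N add.commute)
  have S: "1 / sfun q x Q b3 t = q * b1 * b3 * t"
    by (simp add: sfun_def Qx)
  note den = assms(4-7)[unfolded fden_def gden_def tau]
  have q2: "q\<^sup>2 * b3 = q * (q * b3)" by (simp add: power2_eq_square)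
  define fn where "fn = q * Q * t * b3 * (1 - x) * cas n t b1 (q * b3) * cas (Suc n) (q * t) (b1 / q) (q * b3)"
  define fd where "fd = cas n (q * t) (b1 / q) (q * b3) * cas (Suc n) t b1 (q * b3)"
  define fn' where "fn' = q * Q * (q * t) * b3 * (1 - x) * cas n (q * t) b1 (q * b3)
    * cas (Suc n) (q * (q * t)) (b1 / q) (q * b3)"
  define fd' where "fd' = cas n (q * (q * t)) (b1 / q) (q * b3) * cas (Suc n) (q * t) b1 (q * b3)"
  define gn where "gn = - (cas n t (b1 / q) (q * (q * b3)) * cas (Suc n) t b1 b3)"
  define gd where "gd = cas n t (b1 / q) (q * b3) * cas (Suc n) t b1 (q * b3)"
  define gn' where "gn' = - (cas n (q * t) (b1 / q) (q * (q * b3)) * cas (Suc n) (q * t) b1 b3)"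
  define gd' where "gd' = cas n (q * t) (b1 / q) (q * b3) * cas (Suc n) (q * t) b1 (q * b3)"
  have nz: "fd \<noteq> 0" "fd' \<noteq> 0" "gd \<noteq> 0" "gd' \<noteq> 0"
    using den N by (simp_all add: fd_def fd'_def gd_def gd'_def)
  have sol: "fsol q psi N b1 b3 t = fn / fd" "fsol q psi N b1 b3 (q * t) = fn' / fd'"
    "gsol q psi N b1 b3 t = gn / gd" "gsol q psi N b1 b3 (q * t) = gn' / gd'"
    unfolding fsol_def gsol_def fnum_def fden_def gnum_def gden_def tau pow q2
      fn_def fd_def fn'_def fd'_def gn_def gd_def gn'_def gd'_def
    by (simp_all add: N)
  have u1: "fn + b3 * fd = b3 * (cas (Suc n) (q * t) b1 b3 * cas n t (b1 / q) (q * (q * b3)))"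
    using cas_bilinear_R8[OF b1, of n t b3] unfolding fn_def fd_def Q x by Groebner_Basis.algebra
  have u2: "fn + 1 * fd = Q * (cas (Suc n) t b1 b3 * cas n (q * t) (b1 / q) (q * (q * b3)))"
    using cas_bilinear_R7[OF b3, of n t b1] unfolding fn_def fd_def Q x by Groebner_Basis.algebra
  have u3: "fn + q * b1 * b3 * t * fd = q * t * b3 * (cas (Suc n) (q * t) b1 (q * b3) * cas n t (b1 / q) (q * b3))"
    using cas_bilinear_R1[OF b1, of n t "q * b3"] unfolding fn_def fd_def Q x by Groebner_Basis.algebra
  show "dP_eq1 q (q powi (- N) * b1) (q powi N) b3 (fsol q psi N b1 b3) (gsol q psi N b1 b3) t"
    unfolding dP_eq1_def pow S sol
  proof (rule quotient_identity[OF nz(1,4,3) u1 u2 u3])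
    show "fn / fd + q * b1 * b3 * t \<noteq> 0" using f unfolding pow S sol .
    show "gn' * gn * (q * t * b3 * (cas (Suc n) (q * t) b1 (q * b3) * cas n t (b1 / q) (q * b3))) * fd =
      q * t / Q * (b3 * (cas (Suc n) (q * t) b1 b3 * cas n t (b1 / q) (q * (q * b3))))
      * (Q * (cas (Suc n) t b1 b3 * cas n (q * t) (b1 / q) (q * (q * b3)))) * gd' * gd"
      using Q0 by (simp add: gn_def gn'_def fd_def gd_def gd'_def)
  qed
  have v1: "gn' + 1 / Q * gd' = - (q * q * Q * t * b3 * (1 - x))
      * (cas (Suc n) (q * (q * t)) (b1 / q) (q * b3) * cas n t b1 (q * b3))"
  proof -
    have "Q * gn' + gd' = Q * (- (q * q * Q * t * b3 * (1 - x))
        * (cas (Suc n) (q * (q * t)) (b1 / q) (q * b3) * cas n t b1 (q * b3)))"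
      using cas_bilinear_R7_twisted[OF b1 b3, of n t] unfolding gn'_def gd'_def Q x by Groebner_Basis.algebra
    then show ?thesis using Q0 by (simp add: field_simps)
  qed
  have v2: "gn' + 1 / (x * Q) * gd' = Q * (1 - x) * (1 - q * t * x) / b1
      * (cas n (q * t) b1 (q * b3) * cas (Suc n) (q * t) (b1 / q) (q * b3))"
  proof -
    have "b1 * gn' + gd' = Q * (1 - x) * (1 - q * t * x)
        * (cas n (q * t) b1 (q * b3) * cas (Suc n) (q * t) (b1 / q) (q * b3))"
      using cas_bilinear_R10[OF b1, of n "q * t" b3] unfolding gn'_def gd'_def Q x by Groebner_Basis.algebra
    moreover have "gn' + 1 / (x * Q) * gd' = (b1 * gn' + gd') / b1"
      using b1 by (simp add: Qx field_simps)
    ultimately show ?thesis by simp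
  qed
  have v3: "gn' + q * t / Q * gd' = - (1 - q * t * x)
      * (cas (Suc n) t b1 (q * b3) * cas n (q * (q * t)) (b1 / q) (q * b3))"
  proof -
    have "Q * gn' + q * t * gd' = Q * (- (1 - q * t * x)
        * (cas (Suc n) t b1 (q * b3) * cas n (q * (q * t)) (b1 / q) (q * b3)))"
      using cas_bilinear_R4[OF b1 b3, of n t] unfolding gn'_def gd'_def Q x by Groebner_Basis.algebra
    then show ?thesis using Q0 by (simp add: field_simps)
  qed
  show "dP_eq2 q (q powi (- N) * b1) (q powi N) b3 (fsol q psi N b1 b3) (gsol q psi N b1 b3) t"
    unfolding dP_eq2_def pow S sol
  proof (rule quotient_identity[OF nz(4,2,1) v1 v2 v3])
    show "gn' / gd' + q * t / Q \<noteq> 0" using g unfolding pow sol .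
    show "fn' * fn * (- (1 - q * t * x) * (cas (Suc n) t b1 (q * b3) * cas n (q * (q * t)) (b1 / q) (q * b3))) * gd' =
      q * b1 * b3 * t * (- (q * q * Q * t * b3 * (1 - x))
      * (cas (Suc n) (q * (q * t)) (b1 / q) (q * b3) * cas n t b1 (q * b3)))
      * (Q * (1 - x) * (1 - q * t * x) / b1
      * (cas n (q * t) b1 (q * b3) * cas (Suc n) (q * t) (b1 / q) (q * b3))) * fd' * fd"
    proof -
      \<comment> \<open>Division by \<open>b1\<close> becomes multiplication by \<open>r\<close>
        subject to \<open>b1 * r = 1\<close>, which leaves a polynomial identity.\<close>
      obtain r where r: "b1 * r = 1" "\<And>z. z / b1 = z * r"
        using b1 by (metis divide_inverse right_inverse)
      show ?thesis
        using r(1) unfolding r(2) fn_def fn'_def fd_def fd'_def gd'_def by Groebner_Basis.algebra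
    qed
  qed
qed

lemma dP_solution_neg:
  assumes b1: "b1 \<noteq> 0" and b3: "b3 \<noteq> 0" and N: "N = - int (Suc n)" and t: "t \<noteq> 0"
    and "fden q psi N b1 b3 t \<noteq> 0" "fden q psi N b1 b3 (q * t) \<noteq> 0"
    and "gden q psi N b1 b3 t \<noteq> 0" "gden q psi N b1 b3 (q * t) \<noteq> 0"
    and f: "fsol q psi N b1 b3 t + 1 / sfun q (q powi (- N) * b1) (q powi N) b3 t \<noteq> 0"
    and g: "gsol q psi N b1 b3 (q * t) + q * t / q powi N \<noteq> 0"
  shows "dP_eq1 q (q powi (- N) * b1) (q powi N) b3 (fsol q psi N b1 b3) (gsol q psi N b1 b3) t"
    and "dP_eq2 q (q powi (- N) * b1) (q powi N) b3 (fsol q psi N b1 b3) (gsol q psi N b1 b3) t"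
proof -
  obtain Q where Q: "q ^ n = Q" by simp
  have Q0: "Q \<noteq> 0" using q by (simp flip: Q)
  \<comment> \<open>Normalised so that \<open>tau\<close> of index \<open>N\<close> at
    \<open>q * b1\<close> and \<open>b3\<close> is the determinant of size \<open>n + 1\<close> at
    \<open>x\<close> and \<open>y\<close>. Here \<open>x\<close> is again \<open>B1\<close>, while
    \<open>B2\<close> is \<open>1 / (q * Q)\<close>.\<close>
  define x where "x = q * Q * b1"
  define y where "y = b3 / Q"
  have x0: "x \<noteq> 0" and y0: "y \<noteq> 0" using q Q0 b1 b3 by (simp_all add: x_def y_def)
  have pow: "q powi N = 1 / (q * Q)" "q powi (- N) * b1 = x"
    unfolding N power_int_minus minus_minus power_int_of_nat by (simp_all add: x_def Q divide_inverse)
  have Xx: "X x n = q * b1" and Yy: "Y y n = b3" and xy: "x * y = q * b1 * b3"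
    using q Q0 by (simp_all add: X_def Y_def x_def y_def Q)
  have N1: "N + 1 = - int n" by (simp add: N)
  have tauN: "tau q psi N t (q * b1) b3 = cas (Suc n) t x y"
    "tau q psi N t b1 b3 = cas (Suc n) t (x / q) y"
    "tau q psi N t b1 (q * b3) = cas (Suc n) t (x / q) (q * y)" for t
    using q Q0 unfolding N tau_nonpos by (simp_all add: x_def y_def Q mult_ac)
  have tauN1: "tau q psi (N + 1) t b1 b3 = cas n t (x / q / q) (q * y)"
    "tau q psi (N + 1) t (q * b1) b3 = cas n t (x / q) (q * y)"
    "tau q psi (N + 1) t (q * b1) (b3 / q) = cas n t (x / q) y" for t
    using q Q0 unfolding N1 tau_nonpos by (simp_all add: x_def y_def Q mult_ac)
  have S: "1 / sfun q x (1 / (q * Q)) b3 t = q * b1 * b3 * t"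
    using q Q0 by (simp add: sfun_def x_def)
  note den = assms(5-8)[unfolded fden_def gden_def tauN tauN1]
  define fn where "fn = - (cas (Suc n) t x y * cas n (q * t) (x / q / q) (q * y))"
  define fd where "fd = cas (Suc n) (q * t) (x / q) y * cas n t (x / q) (q * y)"
  define fn' where "fn' = - (cas (Suc n) (q * t) x y * cas n (q * (q * t)) (x / q / q) (q * y))"
  define fd' where "fd' = cas (Suc n) (q * (q * t)) (x / q) y * cas n (q * t) (x / q) (q * y)"
  define gn where "gn = q * t * (b3 - 1) * cas (Suc n) t (x / q) (q * y) * cas n t (x / q) y"
  define gd where "gd = cas (Suc n) t (x / q) y * cas n t (x / q) (q * y)"
  define gn' where "gn' = q * (q * t) * (b3 - 1) * cas (Suc n) (q * t) (x / q) (q * y) * cas n (q * t) (x / q) y"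
  define gd' where "gd' = cas (Suc n) (q * t) (x / q) y * cas n (q * t) (x / q) (q * y)"
  have nz: "fd \<noteq> 0" "fd' \<noteq> 0" "gd \<noteq> 0" "gd' \<noteq> 0"
    using den N by (simp_all add: fd_def fd'_def gd_def gd'_def)
  have sol: "fsol q psi N b1 b3 t = fn / fd" "fsol q psi N b1 b3 (q * t) = fn' / fd'"
    "gsol q psi N b1 b3 t = gn / gd" "gsol q psi N b1 b3 (q * t) = gn' / gd'"
    unfolding fsol_def gsol_def fnum_def fden_def gnum_def gden_def tauN tauN1
      fn_def fd_def fn'_def fd'_def gn_def gd_def gn'_def gd'_def
    by (simp_all add: N)
  have u1: "fn + b3 * fd = - (1 - t * (q * b1)) * (1 - b3) * (cas n (q * t) (x / q) y * cas (Suc n) t (x / q) (q * y))"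
    using cas_bilinear_R13[OF x0 y0 t, of n] unfolding fn_def fd_def Xx Yy by Groebner_Basis.algebra
  have u2: "fn + 1 * fd = q * t * (1 - b3) * (cas n t (x / q) y * cas (Suc n) (q * t) (x / q) (q * y))"
    using cas_bilinear_R12[of n t x y] unfolding fn_def fd_def Xx Yy by Groebner_Basis.algebra
  have u3: "fn + q * b1 * b3 * t * fd = - Q * (1 - t * (q * b1)) * (cas n (q * t) (x / q) (q * y) * cas (Suc n) t (x / q) y)"
    using cas_bilinear_R3[OF x0 y0 t, of n] xy unfolding fn_def fd_def Xx Yy Q by Groebner_Basis.algebra
  show "dP_eq1 q (q powi (- N) * b1) (q powi N) b3 (fsol q psi N b1 b3) (gsol q psi N b1 b3) t"
    unfolding dP_eq1_def pow S sol
  proof (rule quotient_identity[OF nz(1,4,3) u1 u2 u3])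
    show "fn / fd + q * b1 * b3 * t \<noteq> 0" using f unfolding pow S sol .
    have K: "q * t / (1 / (q * Q)) = q * t * (q * Q)" by simp
    show "gn' * gn * (- Q * (1 - t * (q * b1)) * (cas n (q * t) (x / q) (q * y) * cas (Suc n) t (x / q) y)) * fd =
      q * t / (1 / (q * Q)) * (- (1 - t * (q * b1)) * (1 - b3) * (cas n (q * t) (x / q) y * cas (Suc n) t (x / q) (q * y)))
      * (q * t * (1 - b3) * (cas n t (x / q) y * cas (Suc n) (q * t) (x / q) (q * y))) * gd' * gd"
      unfolding K gn_def gn'_def fd_def gd_def gd'_def by Groebner_Basis.algebra
  qed
  have v1: "gn' + 1 / (1 / (q * Q)) * gd' = q * Q * (cas (Suc n) t x y * cas n (q * (q * t)) (x / q / q) (q * y))"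
    using cas_bilinear_R12_twisted[OF x0 y0 t, of n] unfolding gn'_def gd'_def Q Yy by simp Groebner_Basis.algebra
  have v2: "gn' + 1 / (x * (1 / (q * Q))) * gd' =
      (cas (Suc n) (q * t) x y * cas n (q * t) (x / q / q) (q * y)) / (Q * b1)"
  proof -
    have "q * t \<noteq> 0" using q t by simp
    from cas_bilinear_R9[OF x0 this, of n y]
    have "Q * (b1 * gn' + gd') = cas (Suc n) (q * t) x y * cas n (q * t) (x / q / q) (q * y)"
      unfolding gn'_def gd'_def Q Yy by (simp add: x_def algebra_simps)
    moreover have "gn' + 1 / (x * (1 / (q * Q))) * gd' = Q * (b1 * gn' + gd') / (Q * b1)"
      using q b1 Q0 by (simp add: x_def field_simps)
    ultimately show ?thesis by simp
  qed
  have v3: "gn' + q * t / (1 / (q * Q)) * gd' =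
      q * q * t * b3 * (cas (Suc n) (q * (q * t)) (x / q) y * cas n t (x / q) (q * y))"
  proof -
    have "x / q \<noteq> 0" using x0 q by simp
    from cas_bilinear_R2_twisted[OF this y0, of n t] show ?thesis
      unfolding gn'_def gd'_def Q Yy by simp Groebner_Basis.algebra
  qed
  show "dP_eq2 q (q powi (- N) * b1) (q powi N) b3 (fsol q psi N b1 b3) (gsol q psi N b1 b3) t"
    unfolding dP_eq2_def pow S sol
  proof (rule quotient_identity[OF nz(4,2,1) v1 v2 v3])
    show "gn' / gd' + q * t / (1 / (q * Q)) \<noteq> 0" using g unfolding pow sol .
    show "fn' * fn * (q * q * t * b3 * (cas (Suc n) (q * (q * t)) (x / q) y * cas n t (x / q) (q * y))) * gd' =
      q * b1 * b3 * t * (q * Q * (cas (Suc n) t x y * cas n (q * (q * t)) (x / q / q) (q * y)))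
      * ((cas (Suc n) (q * t) x y * cas n (q * t) (x / q / q) (q * y)) / (Q * b1)) * fd' * fd"
      using b1 Q0 by (simp add: fn_def fn'_def fd_def fd'_def gd'_def)
  qed
qed

end

theorem theorem3p1:
  fixes q b1 b3 :: complex and N :: int
    and psi :: "complex \<Rightarrow> complex \<Rightarrow> complex \<Rightarrow> complex"
  assumes hq: "q \<noteq> 0" and hb1: "b1 \<noteq> 0" and hb3: "b3 \<noteq> 0"
    and R1: "\<And>t x y. psi (q * t) x y = x * psi t x y + (1 - x) * psi (q * t) (x / q) y"
    and R2: "\<And>t x y. y * psi (q * t) x y = psi t x y + (y - 1) * psi t x (q * y)"
    and R3: "\<And>t x y. q * t * x * y * psi (q * t) x y = (q * t * x - 1) * psi t x y + psi t (q * x) y"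
    and R4: "\<And>t x y. q * t * psi (q * t) x y = (q * t * x - 1) * psi t x y + psi (q * t) x (y / q)"
  shows "\<forall>t. t \<noteq> 0
     \<and> fden q psi N b1 b3 t \<noteq> 0 \<and> fden q psi N b1 b3 (q * t) \<noteq> 0
     \<and> gden q psi N b1 b3 t \<noteq> 0 \<and> gden q psi N b1 b3 (q * t) \<noteq> 0
     \<and> fsol q psi N b1 b3 t + 1 / sfun q (q powi (- N) * b1) (q powi N) b3 t \<noteq> 0
     \<and> gsol q psi N b1 b3 (q * t) + q * t / q powi N \<noteq> 0
     \<longrightarrow> dP_eq1 q (q powi (- N) * b1) (q powi N) b3 (fsol q psi N b1 b3) (gsol q psi N b1 b3) t
       \<and> dP_eq2 q (q powi (- N) * b1) (q powi N) b3 (fsol q psi N b1 b3) (gsol q psi N b1 b3) t"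
proof -
  interpret contiguity q psi
    by unfold_locales (rule hq R1 R2 R3 R4)+
  consider n where "N = int n" | n where "N = - int (Suc n)"
    by (meson int_cases)
  then show ?thesis
  proof cases
    case 1
    show ?thesis
      by (intro allI impI conjI; elim conjE; rule dP_solution_nonneg[OF hb1 hb3 1]; assumption)
  next
    case 2
    show ?thesis
      by (intro allI impI conjI; elim conjE; rule dP_solution_neg[OF hb1 hb3 2]; assumption)
  qed
qed

end
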